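(* Let $d\ge2$ and let $\mathcal{S}$ be a non-zero proper homogeneous submodule of the Drury-Arveson module $H^2_d$ with $\Delta_{R_{\mathcal{S}}}<\infty$. Then $\mathcal{S}$ is not maximal.
   Context: $H^2_d$ is the Drury-Arveson space: the reproducing kernel Hilbert space of holomorphic functions on the unit ball $\mathbb{B}_d\subset\mathbb{C}^d$ with kernel $K_\lambda(z)=\bigl(1-\sum_{j=1}^dz_j\overline{\lambda_j}\bigr)^{-1}$, $\lambda,z\in\mathbb{B}_d$. $M_{z_i}$ is the operator of multiplication by the coordinate function $z_i$. A submodule of $H^2_d$ is a closed subspace $\mathcal{S}$ with $M_{z_i}\mathcal{S}\subseteq\mathcal{S}$ for $i=1,\dots,d$; it is homogeneous if it is generated (as a closed submodule) by homogeneous polynomials. Put $R_{\mathcal{S}}:=(M_{z_1}|_{\mathcal{S}},\dots,M_{z_d}|_{\mathcal{S}})$, a commuting contractive $d$-tuple on $\mathcal{S}$, where a $d$-tuple $T=(T_1,\dots,T_d)$ of operators is contractive if $\sum_iT_iT_i^*\le I$. For a contractive tuple $T$ let $\Psi_T(X)=\sum_{i=1}^dT_iXT_i^*$, and for $n\in\mathbb{N}=\{1,2,\dots\}$ let $\Delta_T^n:=\dim\overline{\mathrm{ran}}(I-\Psi_T^n(I))$ (the superscript on $\Delta$ is an index, not a power), $\Delta_T:=\Delta_T^1$. A commuting contractive $d$-tuple $T$ with $\Delta_T<\infty$ on an infinite dimensional Hilbert space is maximal if $\Delta_T^n=\Bigl(\sum_{k=0}^{n-1}\binom{k+d-1}{d-1}\Bigr)\Delta_T$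 for all $n\in\mathbb{N}$. The submodule $\mathcal{S}$ is maximal if the tuple $R_{\mathcal{S}}$ is maximal. *)

theory Defs
  imports "HOL-Analysis.Analysis" "HOL-Library.Function_Algebras" "HOL-Library.Extended_Nat"
begin

section \<open>Hilbert spaces of complex-valued functions\<close>

text \<open>
  The linear structure on functions is pointwise. A Hilbert space is a pair \<open>(H, ip)\<close> of a
  carrier set and an inner product (linear in the first argument) of which only the values on
  \<open>H\<close> matter. Likewise an operator on \<open>H\<close> is a total function of which only the values on \<open>H\<close>
  matter, so the restriction of an operator to a subspace \<open>S\<close> is the same function, regarded as
  an operator on \<open>(S, ip)\<close>.
\<close>

definition cscale :: "complex \<Rightarrow> ('x \<Rightarrow> complex) \<Rightarrow> 'x \<Rightarrow> complex"
  where "cscale c f = (\<lambda>x. c * f x)"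

global_interpretation fun_space: vector_space "cscale :: complex \<Rightarrow> ('x \<Rightarrow> complex) \<Rightarrow> _"
  by unfold_locales (auto simp: cscale_def fun_eq_iff algebra_simps)

type_synonym 'x operator = "('x \<Rightarrow> complex) \<Rightarrow> 'x \<Rightarrow> complex"
type_synonym 'x inner_prod = "('x \<Rightarrow> complex) \<Rightarrow> ('x \<Rightarrow> complex) \<Rightarrow> complex"

definition hnorm :: "'x inner_prod \<Rightarrow> ('x \<Rightarrow> complex) \<Rightarrow> real"
  where "hnorm ip f = sqrt (Re (ip f f))"

locale hilbert_space =
  fixes H :: "('x \<Rightarrow> complex) set" and ip :: "'x inner_prod"
  assumes subspace: "fun_space.subspace H"
    and ip_commute: "\<And>f g. f \<in> H \<Longrightarrow> g \<in> H \<Longrightarrow> ip g f = cnj (ip f g)"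
    and ip_add: "\<And>f g h. f \<in> H \<Longrightarrow> g \<in> H \<Longrightarrow> h \<in> H \<Longrightarrow> ip (f + g) h = ip f h + ip g h"
    and ip_scale: "\<And>c f g. f \<in> H \<Longrightarrow> g \<in> H \<Longrightarrow> ip (cscale c f) g = c * ip f g"
    and ip_pos: "\<And>f. f \<in> H \<Longrightarrow> f \<noteq> 0 \<Longrightarrow> 0 < Re (ip f f)"
    and complete: "\<And>X. (\<forall>n::nat. X n \<in> H) \<Longrightarrow>
          (\<forall>e>0. \<exists>N. \<forall>m\<ge>N. \<forall>n\<ge>N. hnorm ip (X m - X n) < e) \<Longrightarrow>
          \<exists>l\<in>H. (\<lambda>n. hnorm ip (X n - l)) \<longlonglongrightarrow> 0"

definition hclosure ::
  "('x \<Rightarrow> complex) set \<Rightarrow> 'x inner_prod \<Rightarrow> ('x \<Rightarrow> complex) set \<Rightarrow> ('x \<Rightarrow> complex) set"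
  where "hclosure H ip A =
    {l \<in> H. \<exists>X. (\<forall>n::nat. X n \<in> A) \<and> (\<lambda>n. hnorm ip (X n - l)) \<longlonglongrightarrow> 0}"

definition closed_subspace ::
  "('x \<Rightarrow> complex) set \<Rightarrow> 'x inner_prod \<Rightarrow> ('x \<Rightarrow> complex) set \<Rightarrow> bool"
  where "closed_subspace H ip S \<longleftrightarrow> S \<subseteq> H \<and> fun_space.subspace S \<and> hclosure H ip S \<subseteq> S"

text \<open>The library's \<open>dim\<close> is 0 on infinite-dimensional spaces, hence the case distinction.\<close>

definition edim :: "('x \<Rightarrow> complex) set \<Rightarrow> enat"
  where "edim V =
    (if \<exists>B. finite B \<and> V \<subseteq> fun_space.span B then enat (fun_space.dim V) else \<infinity>)"

section \<open>Tuples of operators\<close>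

definition bounded_operator ::
  "('x \<Rightarrow> complex) set \<Rightarrow> 'x inner_prod \<Rightarrow> 'x operator \<Rightarrow> bool"
  where "bounded_operator H ip T \<longleftrightarrow>
    T ` H \<subseteq> H \<and>
    (\<forall>f\<in>H. \<forall>g\<in>H. T (f + g) = T f + T g) \<and>
    (\<forall>c. \<forall>f\<in>H. T (cscale c f) = cscale c (T f)) \<and>
    (\<exists>C. \<forall>f\<in>H. hnorm ip (T f) \<le> C * hnorm ip f)"

definition adjoint_op ::
  "('x \<Rightarrow> complex) set \<Rightarrow> 'x inner_prod \<Rightarrow> 'x operator \<Rightarrow> 'x operator"
  where "adjoint_op H ip T g = (THE h. h \<in> H \<and> (\<forall>f\<in>H. ip (T f) g = ip f h))"

definition Psi ::
  "('x \<Rightarrow> complex) set \<Rightarrow> 'x inner_prod \<Rightarrow> ('d::finite \<Rightarrow> 'x operator) \<Rightarrow> 'x operator \<Rightarrow> 'x operator"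
  where "Psi H ip T X = (\<lambda>f. \<Sum>i\<in>UNIV. T i (X (adjoint_op H ip (T i) f)))"

definition commuting_contractive ::
  "('x \<Rightarrow> complex) set \<Rightarrow> 'x inner_prod \<Rightarrow> ('d::finite \<Rightarrow> 'x operator) \<Rightarrow> bool"
  where "commuting_contractive H ip T \<longleftrightarrow>
    (\<forall>i. bounded_operator H ip (T i)) \<and>
    (\<forall>i j. \<forall>f\<in>H. T i (T j f) = T j (T i f)) \<and>
    (\<forall>f\<in>H. ip (f - Psi H ip T id f) f \<in> \<real>\<^sub>\<ge>\<^sub>0)"

definition Delta ::
  "('x \<Rightarrow> complex) set \<Rightarrow> 'x inner_prod \<Rightarrow> ('d::finite \<Rightarrow> 'x operator) \<Rightarrow> nat \<Rightarrow> enat"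
  where "Delta H ip T n =
    edim (hclosure H ip ((\<lambda>f. f - (Psi H ip T ^^ n) id f) ` H))"

definition maximal_tuple ::
  "('x \<Rightarrow> complex) set \<Rightarrow> 'x inner_prod \<Rightarrow> ('d::finite \<Rightarrow> 'x operator) \<Rightarrow> bool"
  where "maximal_tuple H ip T \<longleftrightarrow>
    hilbert_space H ip \<and> edim H = \<infinity> \<and>
    commuting_contractive H ip T \<and> Delta H ip T 1 < \<infinity> \<and>
    (\<forall>n\<ge>1. Delta H ip T n =
      enat (\<Sum>k<n. (k + CARD('d) - 1) choose (CARD('d) - 1)) * Delta H ip T 1)"

section \<open>The Drury-Arveson space and its submodules\<close>

text \<open>
  Functions on a set \<open>X\<close> are represented by their extension by 0 to the whole type.
  In \<open>K l z\<close> the first argument is the base point, i.e. \<open>K l\<close> is the kernel function at \<open>l\<close>.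
\<close>

definition on_set :: "'x set \<Rightarrow> ('x \<Rightarrow> complex) \<Rightarrow> 'x \<Rightarrow> complex"
  where "on_set X f = (\<lambda>x. if x \<in> X then f x else 0)"

locale rkhs = hilbert_space H ip
  for H :: "('x \<Rightarrow> complex) set" and ip :: "'x inner_prod" +
  fixes X :: "'x set" and K :: "'x \<Rightarrow> 'x \<Rightarrow> complex"
  assumes on_X: "\<And>f. f \<in> H \<Longrightarrow> on_set X f = f"
    and kernel_mem: "\<And>l. l \<in> X \<Longrightarrow> on_set X (K l) \<in> H"
    and reproducing: "\<And>f l. f \<in> H \<Longrightarrow> l \<in> X \<Longrightarrow> ip f (on_set X (K l)) = f l"

definition DA_kernel :: "complex ^ 'd \<Rightarrow> complex ^ 'd \<Rightarrow> complex"
  where "DA_kernel l z = inverse (1 - (\<Sum>j\<in>UNIV. z $ j * cnj (l $ j)))"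

text \<open>
  A Hilbert function space is determined by its kernel, including its inner product, so
  \<open>drury_arveson H ip\<close> says that \<open>(H, ip)\<close> is the Drury-Arveson space.
  Holomorphy in several variables is real differentiability with a complex-linear derivative.
\<close>

locale drury_arveson = rkhs H ip "ball 0 1" DA_kernel
  for H :: "(complex ^ 'd \<Rightarrow> complex) set" and ip :: "(complex ^ 'd) inner_prod" +
  assumes holomorphic: "\<And>f z. f \<in> H \<Longrightarrow> z \<in> ball 0 1 \<Longrightarrow>
    \<exists>f'. (f has_derivative f') (at z) \<and> (\<forall>c v. f' (c *s v) = c * f' v)"

definition mult_coord :: "'d \<Rightarrow> (complex ^ 'd) operator"
  where "mult_coord i f = (\<lambda>z. z $ i * f z)"

definition submodule ::
  "(complex ^ 'd \<Rightarrow> complex) set \<Rightarrow> (complex ^ 'd) inner_prod \<Rightarrow> (complex ^ 'd \<Rightarrow> complex) set \<Rightarrow> bool"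
  where "submodule H ip S \<longleftrightarrow>
    closed_subspace H ip S \<and> (\<forall>i. mult_coord i ` S \<subseteq> S)"

definition homogeneous_polynomial :: "nat \<Rightarrow> (complex ^ 'd \<Rightarrow> complex) \<Rightarrow> bool"
  where "homogeneous_polynomial m p \<longleftrightarrow>
    (\<exists>c :: ('d \<Rightarrow> nat) \<Rightarrow> complex.
      p = on_set (ball 0 1)
        (\<lambda>z. \<Sum>a | sum a UNIV = m. c a * (\<Prod>i\<in>UNIV. (z $ i) ^ a i)))"

definition homogeneous_submodule ::
  "(complex ^ 'd \<Rightarrow> complex) set \<Rightarrow> (complex ^ 'd) inner_prod \<Rightarrow> (complex ^ 'd \<Rightarrow> complex) set \<Rightarrow> bool"
  where "homogeneous_submodule H ip S \<longleftrightarrow>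
    submodule H ip S \<and>
    (\<exists>G. (\<forall>p\<in>G. \<exists>m. homogeneous_polynomial m p) \<and> S = submodule H ip hull G)"

definition maximal_submodule ::
  "(complex ^ 'd \<Rightarrow> complex) set \<Rightarrow> (complex ^ 'd) inner_prod \<Rightarrow> (complex ^ 'd \<Rightarrow> complex) set \<Rightarrow> bool"
  where "maximal_submodule H ip S \<longleftrightarrow>
    submodule H ip S \<and> maximal_tuple S ip mult_coord"

end

(* Write R for the restricted shift tuple on S and D = I - Psi_R(I). Since
   I - Psi_R^n(I) = sum over k < n of Psi_R^k(D), the range of I - Psi_R^n(I) is spanned by the
   functions z^a e with |a| < n and e in ran D, so maximality forces ran D to be linearly
   independent over the polynomials.

   Let m be the least degree of a nonzero homogeneous polynomial in S. On degree m the operator D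
   is the identity, so two independent such polynomials p, q would give the relation
   q p - p q = 0. Hence the degree m part of S is spanned by one p. In the same way D (z_j p) = 0,
   that is z_j p = sum_i c_ij z_i p with c_ij = <z_j p, z_i p> / |p|^2, and independence gives
   |z_j p| = |p| for all j. But in the Drury-Arveson space
   sum_j |z_j p|^2 = (m + d) / (m + 1) |p|^2, so (m + d) / (m + 1) = d. As d >= 2, this means m = 0,
   so S contains the constants and S = H. *)

theory Submission
  imports Defs
begin

text \<open>\<open>drury_arveson\<close> supplies only a Hilbert space of functions with a given
  kernel: no orthonormal basis of monomials and no norm formula for z^a. The substitute is the
  expansion of the kernel function at s w in powers of s, whose n-th coefficient is the function <.,
  w>^n. Comparing coefficients of f (s w) at s = 0 puts these powers into H, makes them reproduce
  the values of polynomials of degree n, and shows that the adjoint of M_j sends <., w>^(n+1) to cnj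
  w_j times <., w>^n. As the powers span the homogeneous polynomials in H, that adjoint is the j-th
  partial derivative divided by the degree. The constant (m + d) / (m + 1) is then the product rule
  together with Euler's identity, divided by the degree m + 1 of z_j p. D is the identity in degree
  m because the adjoints lower the degree by one, while S is orthogonal to every polynomial of
  degree below m. Maximality enters as a pure count: there are at most as many products z^a e as the
  required dimension, so one linear relation is already too much. In the relation among the z_i p
  the coefficient of z_j is 1 - c_jj; its vanishing is |z_j p| = |p|.\<close>

section \<open>Finite-dimensional spaces of functions\<close>

lemma cscale_apply: "cscale c f x = c * f x"
  by (simp add: cscale_def)

lemma sum_fun_apply: "(\<Sum>i\<in>I. F i) x = (\<Sum>i\<in>I. F i x)"
  by (induction I rule: infinite_finite_induct) auto

text \<open>A finite-dimensional space of functions has coordinates that are point values. When g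
  joins B, only the remainder of g after interpolation at P matters; it vanishes on P, and any point
  where it is nonzero can be added to P.\<close>

lemma finite_span_interpolation:
  fixes B :: "('x \<Rightarrow> complex) set"
  assumes "finite B"
  shows "\<exists>P b. finite P \<and> (\<forall>x\<in>P. b x \<in> fun_space.span B)
    \<and> (\<forall>x\<in>P. \<forall>y\<in>P. b x y = (if x = y then 1 else 0))
    \<and> (\<forall>f\<in>fun_space.span B. f = (\<Sum>x\<in>P. cscale (f x) (b x)))"
  using assms
proof (induction B rule: finite_induct)
  case empty
  then show ?case
    by (intro exI[of _ "{}"]) simp
next
  case (insert g B)
  then obtain P b where P: "finite P" "\<forall>x\<in>P. b x \<in> fun_space.span B"
    "\<forall>x\<in>P. \<forall>y\<in>P. b x y = (if x = y then 1 else 0)"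
    "\<forall>f\<in>fun_space.span B. f = (\<Sum>x\<in>P. cscale (f x) (b x))"
    by blast
  show ?case
  proof (cases "g \<in> fun_space.span B")
    case True
    show ?thesis
      unfolding fun_space.span_redundant[OF True] using P by blast
  next
    case False
    let ?s = "\<Sum>x\<in>P. cscale (g x) (b x)"
    define g' where "g' = g - ?s"
    have s: "?s \<in> fun_space.span B"
      using P(2) by (intro fun_space.span_sum fun_space.span_scale) auto
    then have "g' \<noteq> 0"
      using False by (auto simp: g'_def)
    then obtain y where y: "g' y \<noteq> 0"
      by (auto simp: fun_eq_iff)
    have g'P: "g' x = 0" if "x \<in> P" for x
    proof -
      have "(\<Sum>x'\<in>P. g x' * b x' x) = (\<Sum>x'\<in>P. if x' = x then g x' else 0)"
        using P(3) that by (intro sum.cong) auto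
      then show ?thesis
        using that P(1) by (simp add: g'_def sum_fun_apply cscale_apply)
    qed
    then have yP: "y \<notin> P"
      using y by auto
    define e where "e = cscale (inverse (g' y)) g'"
    \<comment> \<open>\<open>e\<close> is 1 at y and 0 on P; the old dual functions are corrected so
      that they vanish at y.\<close>
    define b' where "b' x = (if x = y then e else b x - cscale (b x y) e)" for x
    have sub: "h \<in> fun_space.span (insert g B)" if "h \<in> fun_space.span B" for h
      using that fun_space.span_mono[of B "insert g B"] by auto
    have espan: "e \<in> fun_space.span (insert g B)"
      unfolding e_def g'_def
      by (intro fun_space.span_scale fun_space.span_diff sub s fun_space.span_base) auto
    have "b' x \<in> fun_space.span (insert g B)" if "x \<in> insert y P" for x
      using that P(2) espan unfolding b'_def
      by (auto intro!: fun_space.span_diff fun_space.span_scale intro: sub)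
    moreover have "b' x z = (if x = z then 1 else 0)" if "x \<in> insert y P" "z \<in> insert y P" for x z
      using that P(3) g'P y yP by (auto simp: b'_def e_def cscale_apply)
    moreover have "f = (\<Sum>x\<in>insert y P. cscale (f x) (b' x))"
      if "f \<in> fun_space.span (insert g B)" for f
    proof -
      obtain k where k: "f - cscale k g \<in> fun_space.span B"
        using \<open>f \<in> _\<close> fun_space.span_breakdown_eq by blast
      \<comment> \<open>w lies in the old span and agrees with f on P, so the old interpolation
        recovers it from values of f; the value f y then accounts for k.\<close>
      define w where "w = f - cscale k g'"
      have "w = (f - cscale k g) + cscale k ?s"
        by (simp add: w_def g'_def fun_eq_iff cscale_apply algebra_simps)
      then have "w \<in> fun_space.span B"
        using k s by (auto intro: fun_space.span_add fun_space.span_scale)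
      then have w: "w z = (\<Sum>x\<in>P. w x * b x z)" for z
        using P(4) fun_cong[of w _ z] unfolding sum_fun_apply cscale_apply by blast
      have fP: "f x = w x" if "x \<in> P" for x
        using g'P that by (simp add: w_def cscale_apply)
      have f: "f z = w z + k * g' z" for z
        by (simp add: w_def cscale_apply)
      have "(\<Sum>x\<in>insert y P. f x * b' x z) = f z" for z
      proof -
        have "(\<Sum>x\<in>P. f x * b' x z) = (\<Sum>x\<in>P. w x * (b x z - b x y * e z))"
          using fP yP by (intro sum.cong) (auto simp: b'_def cscale_apply)
        also have "\<dots> = (\<Sum>x\<in>P. w x * b x z) - (\<Sum>x\<in>P. w x * b x y) * e z"
          by (simp add: algebra_simps sum_subtractf sum_distrib_left sum_distrib_right)
        also have "\<dots> = w z - w y * e z"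
          by (simp only: w[symmetric])
        finally show ?thesis
          using P(1) yP y by (simp add: b'_def f e_def cscale_apply field_simps)
      qed
      then show ?thesis
        by (simp add: fun_eq_iff sum_fun_apply cscale_apply)
    qed
    ultimately show ?thesis
      using P(1) by (intro exI[of _ "insert y P"] exI[of _ b']) blast
  qed
qed

text \<open>Coordinates are values at finitely many points, so they converge along with the
  functions. Closedness of finite-dimensional subspaces is obtained this way, with no comparison of
  norms.\<close>

lemma finite_span_pointwise_closed:
  fixes B :: "('x \<Rightarrow> complex) set"
  assumes "finite B" and "\<And>n::nat. X n \<in> fun_space.span B" and "\<And>z. (\<lambda>n. X n z) \<longlonglongrightarrow> l z"
  shows "l \<in> fun_space.span B"
proof -
  obtain P b where P: "finite P" "\<forall>x\<in>P. b x \<in> fun_space.span B"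
    "\<forall>f\<in>fun_space.span B. f = (\<Sum>x\<in>P. cscale (f x) (b x))"
    using finite_span_interpolation[OF assms(1)] by blast
  have "l z = (\<Sum>x\<in>P. l x * b x z)" for z
  proof -
    have "X n z = (\<Sum>x\<in>P. X n x * b x z)" for n
      using P(3) assms(2)[of n] fun_cong[of "X n" _ z] unfolding sum_fun_apply cscale_apply by blast
    then have X: "(\<lambda>n. X n z) = (\<lambda>n. \<Sum>x\<in>P. X n x * b x z)"
      by blast
    have "(\<lambda>n. X n z) \<longlonglongrightarrow> (\<Sum>x\<in>P. l x * b x z)"
      by (subst X) (intro tendsto_intros assms(3))
    then show ?thesis
      using assms(3) LIMSEQ_unique by blast
  qed
  then have l: "l = (\<Sum>x\<in>P. cscale (l x) (b x))"
    unfolding fun_eq_iff sum_fun_apply cscale_apply by blast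
  have "(\<Sum>x\<in>P. cscale (l x) (b x)) \<in> fun_space.span B"
    using P(2) by (intro fun_space.span_sum fun_space.span_scale) auto
  then show ?thesis
    by (subst l)
qed

section \<open>Hilbert spaces of functions\<close>

context hilbert_space
begin

lemma zero_mem [simp]: "0 \<in> H"
  and add_mem [intro]: "f \<in> H \<Longrightarrow> g \<in> H \<Longrightarrow> f + g \<in> H"
  and diff_mem [intro]: "f \<in> H \<Longrightarrow> g \<in> H \<Longrightarrow> f - g \<in> H"
  and scale_mem [intro]: "f \<in> H \<Longrightarrow> cscale c f \<in> H"
  and sum_mem: "(\<And>i. i \<in> I \<Longrightarrow> F i \<in> H) \<Longrightarrow> sum F I \<in> H"
  using subspace
  by (auto intro: fun_space.subspace_0 fun_space.subspace_add fun_space.subspace_diff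
      fun_space.subspace_scale fun_space.subspace_sum)

lemma ip_zero_left [simp]: "g \<in> H \<Longrightarrow> ip 0 g = 0"
  using ip_scale[of 0 g 0] by simp

lemma ip_zero_right [simp]: "g \<in> H \<Longrightarrow> ip g 0 = 0"
  using ip_commute[of 0 g] by simp

lemma ip_diff: "f \<in> H \<Longrightarrow> g \<in> H \<Longrightarrow> h \<in> H \<Longrightarrow> ip (f - g) h = ip f h - ip g h"
  using ip_add[of "f - g" g h] by (simp add: diff_mem)

lemma ip_add_right: "f \<in> H \<Longrightarrow> g \<in> H \<Longrightarrow> h \<in> H \<Longrightarrow> ip h (f + g) = ip h f + ip h g"
  using ip_add[of f g h] by (simp add: ip_commute[of _ h] add_mem)

lemma ip_diff_right: "f \<in> H \<Longrightarrow> g \<in> H \<Longrightarrow> h \<in> H \<Longrightarrow> ip h (f - g) = ip h f - ip h g"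
  using ip_diff[of f g h] by (simp add: ip_commute[of _ h] diff_mem)

lemma ip_scale_right: "f \<in> H \<Longrightarrow> g \<in> H \<Longrightarrow> ip g (cscale c f) = cnj c * ip g f"
  using ip_scale[of f g c] by (simp add: ip_commute[of _ g] scale_mem)

lemma ip_sum: "(\<And>i. i \<in> I \<Longrightarrow> F i \<in> H) \<Longrightarrow> h \<in> H \<Longrightarrow> ip (sum F I) h = (\<Sum>i\<in>I. ip (F i) h)"
  by (induction I rule: infinite_finite_induct) (auto simp: ip_add sum_mem)

lemma ip_sum_right: "(\<And>i. i \<in> I \<Longrightarrow> F i \<in> H) \<Longrightarrow> h \<in> H \<Longrightarrow> ip h (sum F I) = (\<Sum>i\<in>I. ip h (F i))"
  by (induction I rule: infinite_finite_induct) (auto simp: ip_add_right sum_mem)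

lemma ip_self_real: "f \<in> H \<Longrightarrow> ip f f = of_real (Re (ip f f))"
  using ip_commute[of f f] by (simp add: complex_eq_iff)

lemma ip_self_nonneg: "f \<in> H \<Longrightarrow> 0 \<le> Re (ip f f)"
  using ip_pos[of f] by (cases "f = 0") auto

lemma ip_self_eq_0: "f \<in> H \<Longrightarrow> ip f f = 0 \<Longrightarrow> f = 0"
  using ip_pos[of f] by fastforce

lemma ip_orthogonal_sym: "f \<in> H \<Longrightarrow> g \<in> H \<Longrightarrow> ip f g = 0 \<Longrightarrow> ip g f = 0"
  by (simp add: ip_commute[of f g])

lemma hnorm_nonneg: "f \<in> H \<Longrightarrow> 0 \<le> hnorm ip f"
  by (simp add: hnorm_def ip_self_nonneg)

lemma hnorm_squared: "f \<in> H \<Longrightarrow> (hnorm ip f)\<^sup>2 = Re (ip f f)"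
  by (simp add: hnorm_def ip_self_nonneg)

lemma Re_ip_commute: "f \<in> H \<Longrightarrow> g \<in> H \<Longrightarrow> Re (ip g f) = Re (ip f g)"
  by (simp add: ip_commute[of f g])

lemma Re_ip_diff_self:
  "f \<in> H \<Longrightarrow> g \<in> H \<Longrightarrow> Re (ip (f - g) (f - g)) = Re (ip f f) - 2 * Re (ip f g) + Re (ip g g)"
  by (simp add: ip_diff ip_diff_right diff_mem Re_ip_commute[of f g])

lemma Re_ip_add_self:
  "f \<in> H \<Longrightarrow> g \<in> H \<Longrightarrow> Re (ip (f + g) (f + g)) = Re (ip f f) + 2 * Re (ip f g) + Re (ip g g)"
  by (simp add: ip_add ip_add_right add_mem Re_ip_commute[of f g])

lemma cauchy_schwarz:
  assumes f: "f \<in> H" and g: "g \<in> H"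
  shows "cmod (ip f g) \<le> hnorm ip f * hnorm ip g"
proof (cases "g = 0")
  case True
  then show ?thesis
    using assms by (simp add: hnorm_def)
next
  case False
  define r where "r = Re (ip g g)"
  have r: "r > 0" "ip g g = of_real r"
    using ip_pos[OF g False] ip_self_real[OF g] by (auto simp: r_def)
  \<comment> \<open>\<open>cscale c g\<close> is the orthogonal projection of f to the line of
    g.\<close>
  define c where "c = ip f g / of_real r"
  have cg: "cscale c g \<in> H"
    using g by blast
  have "ip f (cscale c g) = of_real ((cmod (ip f g))\<^sup>2 / r)"
    using r by (simp add: ip_scale_right f g c_def complex_norm_square[symmetric] mult.commute)
  moreover have "ip (cscale c g) (cscale c g) = of_real ((cmod (ip f g))\<^sup>2 / r)"
  proof -
    have "ip (cscale c g) (cscale c g) = (c * cnj c) * of_real r"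
      using g cg r by (simp add: ip_scale ip_scale_right)
    also have "c * cnj c = of_real ((cmod c)\<^sup>2)"
      by (simp only: complex_norm_square)
    finally show ?thesis
      using r(1) by (simp add: c_def norm_divide power2_eq_square)
  qed
  ultimately have "Re (ip (f - cscale c g) (f - cscale c g)) = Re (ip f f) - (cmod (ip f g))\<^sup>2 / r"
    using Re_ip_diff_self[OF f cg] by simp
  moreover have "0 \<le> Re (ip (f - cscale c g) (f - cscale c g))"
    using f cg by (intro ip_self_nonneg) blast
  ultimately have "(cmod (ip f g))\<^sup>2 / r \<le> Re (ip f f)"
    by simp
  then have "(cmod (ip f g))\<^sup>2 \<le> Re (ip f f) * r"
    using r(1) by (simp add: field_simps)
  also have "\<dots> = (hnorm ip f * hnorm ip g)\<^sup>2"
    by (simp add: power_mult_distrib hnorm_squared f g r_def)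
  finally show ?thesis
    using hnorm_nonneg f g by (meson mult_nonneg_nonneg power2_le_imp_le)
qed

lemma tendsto_ip:
  assumes "\<And>n::nat. X n \<in> H" "l \<in> H" "g \<in> H" "(\<lambda>n. hnorm ip (X n - l)) \<longlonglongrightarrow> 0"
  shows "(\<lambda>n. ip (X n) g) \<longlonglongrightarrow> ip l g"
proof -
  have "(\<lambda>n. hnorm ip (X n - l) * hnorm ip g) \<longlonglongrightarrow> 0 * hnorm ip g"
    by (intro tendsto_intros assms)
  then have "(\<lambda>n. ip (X n) g - ip l g) \<longlonglongrightarrow> 0"
    by (rule Lim_null_comparison[rotated, OF tendsto_eq_rhs])
       (use cauchy_schwarz assms in \<open>auto simp: ip_diff[symmetric] diff_mem\<close>)
  then show ?thesis
    using Lim_null by blast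
qed

lemma tendsto_ip_right:
  assumes "\<And>n::nat. X n \<in> H" "l \<in> H" "g \<in> H" "(\<lambda>n. hnorm ip (X n - l)) \<longlonglongrightarrow> 0"
  shows "(\<lambda>n. ip g (X n)) \<longlonglongrightarrow> ip g l"
proof -
  have "(\<lambda>n. cnj (ip (X n) g)) \<longlonglongrightarrow> cnj (ip l g)"
    by (intro tendsto_intros tendsto_ip assms)
  then show ?thesis
    using assms by (simp add: ip_commute[of _ g])
qed

text \<open>The representing vector minimizes \<open>\<parallel>x\<parallel>\<^sup>2 - 2 Re (\<phi> x)\<close>.\<close>

theorem riesz_representation:
  assumes add: "\<And>f g. f \<in> H \<Longrightarrow> g \<in> H \<Longrightarrow> \<phi> (f + g) = \<phi> f + \<phi> g"
    and scale: "\<And>c f. f \<in> H \<Longrightarrow> \<phi> (cscale c f) = c * \<phi> f"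
    and bound: "\<And>f. f \<in> H \<Longrightarrow> cmod (\<phi> f) \<le> C * hnorm ip f"
  shows "\<exists>h\<in>H. \<forall>f\<in>H. \<phi> f = ip f h"
proof -
  define J where "J f = Re (ip f f) - 2 * Re (\<phi> f)" for f
  have J_lower: "- C\<^sup>2 \<le> J f" if "f \<in> H" for f
  proof -
    have "Re (\<phi> f) \<le> C * hnorm ip f"
      using bound[OF that] complex_Re_le_cmod[of "\<phi> f"] by linarith
    moreover have "0 \<le> (hnorm ip f - C)\<^sup>2"
      by simp
    ultimately show ?thesis
      using hnorm_squared[OF that] by (simp add: J_def power2_eq_square algebra_simps)
  qed
  define I where "I = Inf (J ` H)"
  have bdd: "bdd_below (J ` H)"
    using J_lower by (auto simp: bdd_below_def)
  have I_le: "I \<le> J f" if "f \<in> H" for f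
    unfolding I_def using that bdd by (intro cInf_lower) auto
  have "\<exists>x\<in>H. J x < I + inverse (real (Suc n))" for n
  proof -
    have "\<exists>y\<in>J ` H. y < I + inverse (real (Suc n))"
      unfolding I_def by (intro cInf_lessD) (use zero_mem in \<open>blast, simp\<close>)
    then show ?thesis by auto
  qed
  then obtain X where X: "\<And>n. X n \<in> H" "\<And>n. J (X n) < I + inverse (real (Suc n))"
    by metis
  \<comment> \<open>Parallelogram law for \<open>J\<close>, whose linear part cancels. Since
    \<open>J\<close> is at least \<open>I\<close> at the midpoint, two near-minimizers must be close
    to each other.\<close>
  have par: "(hnorm ip (x - y))\<^sup>2 = 2 * (J x + J y - 2 * J (cscale (1/2) (x + y)))"
    if xy: "x \<in> H" "y \<in> H" for x y
  proof -
    have e1: "ip (cscale (1/2) (x + y)) (cscale (1/2) (x + y)) = ip (x + y) (x + y) / 4"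
      using xy by (simp add: ip_scale ip_scale_right add_mem scale_mem)
    have e2: "\<phi> (cscale (1/2) (x + y)) = (\<phi> x + \<phi> y) / 2"
      using xy by (simp add: scale add add_mem)
    have e3: "J (cscale (1/2) (x + y)) = Re (ip (x + y) (x + y)) / 4 - Re (\<phi> x) - Re (\<phi> y)"
      unfolding J_def e1 e2 by (simp add: add_divide_distrib)
    show ?thesis
      unfolding e3 J_def[of x] J_def[of y]
      using xy by (simp add: hnorm_squared diff_mem Re_ip_diff_self Re_ip_add_self field_simps)
  qed
  have cauchy: "(hnorm ip (X m - X n))\<^sup>2 \<le> 2 * (inverse (real (Suc m)) + inverse (real (Suc n)))" for m n
  proof -
    have "cscale (1/2) (X m + X n) \<in> H"
      using X(1) by blast
    then show ?thesis
      using par[OF X(1)[of m] X(1)[of n]] X(2)[of m] X(2)[of n] I_le by smt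
  qed
  have "\<forall>e>0. \<exists>N. \<forall>m\<ge>N. \<forall>n\<ge>N. hnorm ip (X m - X n) < e"
  proof (intro allI impI)
    fix e :: real
    assume "e > 0"
    then obtain N where N: "inverse (real (Suc N)) < e\<^sup>2 / 4"
      using reals_Archimedean[of "e\<^sup>2 / 4"] by auto
    have "hnorm ip (X m - X n) < e" if "m \<ge> N" "n \<ge> N" for m n
    proof -
      have "inverse (real (Suc m)) \<le> inverse (real (Suc N))" "inverse (real (Suc n)) \<le> inverse (real (Suc N))"
        using that by (auto intro!: le_imp_inverse_le)
      moreover have "x < y" if "x \<le> 2 * (a + b)" "a \<le> c" "b \<le> c" "c < y / 4" for a b c x y :: real
        using that by (simp add: distrib_left)
      ultimately have "(hnorm ip (X m - X n))\<^sup>2 < e\<^sup>2"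
        using cauchy[of m n] N by blast
      then show ?thesis
        using \<open>e > 0\<close> by (meson less_imp_le power2_less_imp_less)
    qed
    then show "\<exists>N. \<forall>m\<ge>N. \<forall>n\<ge>N. hnorm ip (X m - X n) < e"
      by blast
  qed
  then obtain h where h: "h \<in> H" "(\<lambda>n. hnorm ip (X n - h)) \<longlonglongrightarrow> 0"
    using complete X(1) by blast
  have Re_eq: "Re (\<phi> f) = Re (ip f h)" if f: "f \<in> H" for f
  proof -
    define a where "a = Re (ip f f)"
    define b where "b = Re (ip f h) - Re (\<phi> f)"
    \<comment> \<open>Moving the near-minimizers \<open>X n\<close> by t f cannot bring
      \<open>J\<close> below \<open>I\<close>; in the limit this is a quadratic in t that is never
      negative.\<close>
    have quad: "0 \<le> t\<^sup>2 * a + 2 * t * b" for t :: real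
    proof -
      have "J (X n + cscale (of_real t) f) = J (X n) + t\<^sup>2 * a + 2 * t * (Re (ip f (X n)) - Re (\<phi> f))" for n
        using X(1)[of n] f
        by (simp add: J_def Re_ip_add_self scale_mem ip_scale ip_scale_right add scale a_def
            power2_eq_square Re_ip_commute[of "X n" f] algebra_simps)
      moreover have "I \<le> J (X n + cscale (of_real t) f)" for n
        using X(1)[of n] f by (intro I_le) blast
      ultimately have "0 \<le> inverse (real (Suc n)) + t\<^sup>2 * a + 2 * t * (Re (ip f (X n)) - Re (\<phi> f))" for n
        using X(2)[of n] by (smt (verit))
      moreover have "(\<lambda>n. inverse (real (Suc n)) + t\<^sup>2 * a + 2 * t * (Re (ip f (X n)) - Re (\<phi> f)))
          \<longlonglongrightarrow> 0 + t\<^sup>2 * a + 2 * t * b"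
        unfolding b_def
        by (intro tendsto_intros LIMSEQ_inverse_real_of_nat tendsto_ip_right X(1) h f)
      ultimately show ?thesis
        by (metis (no_types, lifting) LIMSEQ_le_const add_0)
    qed
    have "b = 0"
    proof (rule ccontr)
      assume "b \<noteq> 0"
      have "a \<ge> 0"
        using ip_self_nonneg[OF f] by (simp add: a_def)
      \<comment> \<open>The quadratic has its minimum at - b / a; the added 1 covers a = 0 and still
        gives a negative value.\<close>
      define t where "t = - b / (a + 1)"
      have "t\<^sup>2 * a + 2 * t * b = - (b\<^sup>2 * (a + 2)) / (a + 1)\<^sup>2"
        using \<open>a \<ge> 0\<close> by (simp add: t_def power2_eq_square divide_simps) (simp add: algebra_simps)
      moreover have "\<dots> < 0"
        using \<open>a \<ge> 0\<close> \<open>b \<noteq> 0\<close> by (intro divide_neg_pos) (auto intro!: mult_pos_pos)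
      ultimately show False
        using quad[of t] by linarith
    qed
    then show ?thesis
      by (simp add: b_def)
  qed
  \<comment> \<open>The real parts at f and at i f together determine the complex value.\<close>
  have "\<phi> f = ip f h" if f: "f \<in> H" for f
    using Re_eq[OF f] Re_eq[of "cscale \<i> f"] f h(1)
    by (simp add: complex_eq_iff scale ip_scale scale_mem)
  then show ?thesis
    using h(1) by blast
qed

lemma ip_right_inject:
  assumes "h \<in> H" "h' \<in> H" "\<And>f. f \<in> H \<Longrightarrow> ip f h = ip f h'"
  shows "h = h'"
proof -
  have "ip (h - h') (h - h') = 0"
    using assms by (simp add: ip_diff_right diff_mem)
  then have "h - h' = 0"
    using ip_self_eq_0 assms diff_mem by blast
  then show ?thesis by simp
qed

lemma adjoint_op_eqI:
  assumes "h \<in> H" "\<And>f. f \<in> H \<Longrightarrow> ip (T f) g = ip f h"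
  shows "adjoint_op H ip T g = h"
  unfolding adjoint_op_def
proof (rule the_equality)
  show "k = h" if "k \<in> H \<and> (\<forall>f\<in>H. ip (T f) g = ip f k)" for k
    using that assms by (intro ip_right_inject) auto
qed (use assms in auto)

text \<open>Riesz, applied to the functional f |-> <T f, g>, yields the vector that the
  \<open>THE\<close> in \<open>adjoint_op\<close> describes; before that the description might
  denote nothing.\<close>

lemma adjoint_op_mem:
  assumes "bounded_operator H ip T" "g \<in> H"
  shows "adjoint_op H ip T g \<in> H"
proof -
  obtain C where C: "\<And>f. f \<in> H \<Longrightarrow> hnorm ip (T f) \<le> C * hnorm ip f"
    using assms(1) unfolding bounded_operator_def by blast
  have T: "\<And>f. f \<in> H \<Longrightarrow> T f \<in> H"
    "\<And>f g. f \<in> H \<Longrightarrow> g \<in> H \<Longrightarrow> T (f + g) = T f + T g"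
    "\<And>c f. f \<in> H \<Longrightarrow> T (cscale c f) = cscale c (T f)"
    using assms(1) unfolding bounded_operator_def by auto
  have "\<exists>h\<in>H. \<forall>f\<in>H. ip (T f) g = ip f h"
  proof (rule riesz_representation[where C = "C * hnorm ip g"])
    fix f assume f: "f \<in> H"
    have "cmod (ip (T f) g) \<le> hnorm ip (T f) * hnorm ip g"
      using T(1) f assms(2) by (intro cauchy_schwarz)
    also have "\<dots> \<le> C * hnorm ip f * hnorm ip g"
      using C f assms(2) hnorm_nonneg by (intro mult_right_mono) auto
    finally show "cmod (ip (T f) g) \<le> C * hnorm ip g * hnorm ip f"
      by (simp add: mult_ac)
  qed (use T assms(2) in \<open>auto simp: ip_add ip_scale\<close>)
  then show ?thesis
    using adjoint_op_eqI[of _ T g] by auto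
qed

end

section \<open>Linear relations and dimension bounds\<close>

lemma fun_space_linear_span:
  assumes "\<And>f g. L (f + g) = L f + L g" "\<And>c f. L (cscale c f) = cscale c (L f)"
    and "\<And>f. f \<in> A \<Longrightarrow> L f \<in> fun_space.span B" and "f \<in> fun_space.span A"
  shows "L f \<in> fun_space.span B"
proof -
  have L0: "L 0 = 0"
    using assms(2)[of 0 0] by (simp add: cscale_def zero_fun_def)
  have "fun_space.subspace {f. L f \<in> fun_space.span B}"
    by (rule fun_space.subspaceI)
      (auto simp: assms(1,2) L0 intro: fun_space.span_zero fun_space.span_add fun_space.span_scale)
  then show ?thesis
    using fun_space.span_induct[OF assms(4), of "\<lambda>f. L f \<in> fun_space.span B"] assms(3) by auto
qed

text \<open>Stated for an indexed family because v need not be injective: a coincidence of two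
  members is itself a relation, and dropping an index is what lowers the later count.\<close>

lemma span_image_remove_dependent:
  assumes "finite I" "i0 \<in> I" "(\<Sum>i\<in>I. cscale (c i) (v i)) = 0" "c i0 \<noteq> 0"
  shows "fun_space.span (v ` I) \<subseteq> fun_space.span (v ` (I - {i0}))"
proof -
  have "cscale (c i0) (v i0) = - (\<Sum>i\<in>I - {i0}. cscale (c i) (v i))"
    using assms(1-3) by (simp add: sum.remove eq_neg_iff_add_eq_0)
  also have "\<dots> \<in> fun_space.span (v ` (I - {i0}))"
    by (intro fun_space.span_neg fun_space.span_sum fun_space.span_scale fun_space.span_base) auto
  finally have "cscale (inverse (c i0)) (cscale (c i0) (v i0)) \<in> fun_space.span (v ` (I - {i0}))"
    by (rule fun_space.span_scale)
  then have "v i0 \<in> fun_space.span (v ` (I - {i0}))"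
    using assms(4) by simp
  moreover have "v ` I = insert (v i0) (v ` (I - {i0}))"
    using assms(2) by auto
  ultimately show ?thesis
    by (simp add: fun_space.span_redundant)
qed

lemma edim_le_card:
  assumes "U \<subseteq> fun_space.span B" "finite B"
  shows "edim U \<le> enat (card B)"
  using assms by (auto simp: edim_def intro!: fun_space.dim_le_card)

lemma edim_finite_basis:
  assumes "edim V < \<infinity>"
  obtains C where "finite C" "fun_space.independent C" "C \<subseteq> V" "V \<subseteq> fun_space.span C"
    "edim V = enat (card C)"
proof -
  obtain B where B: "finite B" "V \<subseteq> fun_space.span B"
    using assms by (auto simp: edim_def split: if_splits)
  obtain C where C: "C \<subseteq> V" "fun_space.independent C" "V \<subseteq> fun_space.span C" "card C = fun_space.dim V"
    using fun_space.basis_exists by blast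
  moreover have "finite C"
    using fun_space.independent_span_bound[OF B(1) C(2)] B(2) C(1) by auto
  moreover have "edim V = enat (card C)"
    using B C by (auto simp: edim_def)
  ultimately show ?thesis
    using that by blast
qed

section \<open>Monomials\<close>

definition monomial :: "('d::finite \<Rightarrow> nat) \<Rightarrow> complex ^ 'd \<Rightarrow> complex"
  where "monomial a z = (\<Prod>i\<in>UNIV. (z $ i) ^ a i)"

definition mult_monomial :: "('d::finite \<Rightarrow> nat) \<Rightarrow> (complex ^ 'd) operator"
  where "mult_monomial a f = (\<lambda>z. monomial a z * f z)"

definition exponents_below :: "nat \<Rightarrow> ('d::finite \<Rightarrow> nat) set"
  where "exponents_below n = {a. sum a UNIV < n}"

lemma monomial_add: "monomial (\<lambda>i. a i + b i) z = monomial a z * monomial b z"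
  by (simp add: monomial_def power_add prod.distrib)

lemma monomial_zero [simp]: "monomial (\<lambda>_. 0) z = 1"
  by (simp add: monomial_def)

lemma monomial_unit [simp]: "monomial (\<lambda>k. if k = i then 1 else 0) z = z $ i"
proof -
  have "monomial (\<lambda>k. if k = i then 1 else 0) z = (\<Prod>k\<in>UNIV. if k = i then z $ k else 1)"
    unfolding monomial_def by (intro prod.cong) auto
  then show ?thesis
    by simp
qed

lemma mult_coord_mult_monomial:
  "mult_coord i (mult_monomial a f) = mult_monomial (\<lambda>k. a k + (if k = i then 1 else 0)) f"
  unfolding mult_coord_def mult_monomial_def monomial_add monomial_unit by (simp add: mult_ac)

lemma mult_coord_add: "mult_coord i (f + g) = mult_coord i f + mult_coord i g"
  and mult_coord_cscale: "mult_coord i (cscale c f) = cscale c (mult_coord i f)"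
  by (simp_all add: mult_coord_def cscale_def fun_eq_iff algebra_simps)

lemma mult_coord_diff: "mult_coord i (f - g) = mult_coord i f - mult_coord i g"
  by (simp add: mult_coord_def fun_eq_iff algebra_simps)

text \<open>Listing the indices turns exponents into lists of fixed length and sum, which stars and
  bars counts.\<close>

lemma
  shows finite_exponents: "finite {a :: 'd::finite \<Rightarrow> nat. sum a UNIV = k}" (is ?fin)
    and card_exponents_le:
      "card {a :: 'd \<Rightarrow> nat. sum a UNIV = k} \<le> (k + CARD('d) - 1) choose (CARD('d) - 1)" (is ?card)
proof -
  obtain xs where xs: "set xs = (UNIV :: 'd set)" "distinct xs"
    using finite_distinct_list[OF finite_class.finite_UNIV] by blast
  then have len: "length xs = CARD('d)"
    using distinct_card by metis
  define L where "L = {l :: nat list. length l = CARD('d) \<and> sum_list l = k}"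
  have "k \<le> k + CARD('d) - 1"
    using zero_less_card_finite[where 'a = 'd] by linarith
  then have cardL: "card L = (k + CARD('d) - 1) choose (CARD('d) - 1)"
    unfolding L_def card_length_sum_list
    by (subst binomial_symmetric) auto
  \<comment> \<open>\<open>card\<close> is 0 on infinite sets, so a positive count shows that
    \<open>L\<close> is finite.\<close>
  moreover have "0 < (k + CARD('d) - 1) choose (CARD('d) - 1)"
    by (intro zero_less_binomial) auto
  ultimately have finL: "finite L"
    using card_gt_0_iff by metis
  have inj: "inj_on (\<lambda>a. map a xs) {a. sum a UNIV = k}"
    by (intro inj_onI) (auto simp: fun_eq_iff map_eq_conv xs(1))
  have sub: "(\<lambda>a. map a xs) ` {a. sum a UNIV = k} \<subseteq> L"
    using xs len by (auto simp: L_def sum_list_distinct_conv_sum_set)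
  show ?fin
    using inj_on_finite[OF inj sub finL] .
  show ?card
    using card_inj_on_le[OF inj sub finL] cardL by simp
qed

lemma finite_exponents_below [simp]: "finite (exponents_below n :: ('d::finite \<Rightarrow> nat) set)"
proof -
  have "exponents_below n = (\<Union>k<n. {a :: 'd \<Rightarrow> nat. sum a UNIV = k})"
    by (auto simp: exponents_below_def)
  then show ?thesis
    using finite_exponents by (metis finite_UN_I finite_lessThan)
qed

lemma card_exponents_below_le:
  "card (exponents_below n :: ('d::finite \<Rightarrow> nat) set)
    \<le> (\<Sum>k<n. (k + CARD('d) - 1) choose (CARD('d) - 1))"
proof -
  have "exponents_below n = (\<Union>k<n. {a :: 'd \<Rightarrow> nat. sum a UNIV = k})"
    by (auto simp: exponents_below_def)
  then have "card (exponents_below n :: ('d \<Rightarrow> nat) set) \<le> (\<Sum>k<n. card {a :: 'd \<Rightarrow> nat. sum a UNIV = k})"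
    by (simp add: card_UN_le)
  also have "\<dots> \<le> (\<Sum>k<n. (k + CARD('d) - 1) choose (CARD('d) - 1))"
    by (intro sum_mono card_exponents_le)
  finally show ?thesis .
qed

section \<open>The defect space of a submodule\<close>

text \<open>On X evaluation is the inner product with a kernel function, hence continuous; off X all
  members of H vanish.\<close>

lemma (in rkhs) tendsto_pointwise:
  assumes "\<And>n::nat. F n \<in> H" "l \<in> H" "(\<lambda>n. hnorm ip (F n - l)) \<longlonglongrightarrow> 0"
  shows "(\<lambda>n. F n z) \<longlonglongrightarrow> l z"
proof (cases "z \<in> X")
  case True
  then show ?thesis
    using tendsto_ip[OF assms(1,2) kernel_mem[OF True] assms(3)] assms(1,2)
    by (simp add: reproducing)
next
  case False
  then have "f z = 0" if "f \<in> H" for f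
    using fun_cong[OF on_X[OF that], of z] by (simp add: on_set_def)
  then have "F n z = 0" "l z = 0" for n
    using assms(1,2) by blast+
  then show ?thesis
    by simp
qed

text \<open>Lets \<open>Delta\<close> be bounded by a spanning set of the bare range: norm limits
  are pointwise limits, and these stay in a finite span.\<close>

lemma (in rkhs) hclosure_subset_finite_span:
  assumes "S \<subseteq> H" "A \<subseteq> S" "A \<subseteq> fun_space.span B" "finite B"
  shows "hclosure S ip A \<subseteq> fun_space.span B"
proof
  fix l assume "l \<in> hclosure S ip A"
  then obtain F where F: "l \<in> S" "\<And>n::nat. F n \<in> A" "(\<lambda>n. hnorm ip (F n - l)) \<longlonglongrightarrow> 0"
    unfolding hclosure_def by blast
  have "F n \<in> H" for n
    using F(2)[of n] assms(1,2) by blast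
  then have lim: "(\<lambda>n. F n z) \<longlonglongrightarrow> l z" for z
    using F(1,3) assms(1) by (intro tendsto_pointwise) auto
  have "F n \<in> fun_space.span B" for n
    using F(2)[of n] assms(3) by blast
  then show "l \<in> fun_space.span B"
    by (rule finite_span_pointwise_closed[OF assms(4) _ lim])
qed

text \<open>Completeness of S and boundedness on S are both contained in
  \<open>maximal_tuple\<close>, so they are taken over as assumptions instead of being derived from
  the kernel.\<close>

locale coordinate_invariant = rkhs H ip X K
  for H :: "(complex ^ 'd \<Rightarrow> complex) set" and ip X K +
  fixes S
  assumes S_subset: "S \<subseteq> H"
    and S_hilbert: "hilbert_space S ip"
    and bounded: "\<And>i. bounded_operator S ip (mult_coord i)"
begin

sublocale S: hilbert_space S ip
  by (rule S_hilbert)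

abbreviation shift_adj :: "'d \<Rightarrow> (complex ^ 'd) operator"
  where "shift_adj i \<equiv> adjoint_op S ip (mult_coord i)"

abbreviation PsiS :: "(complex ^ 'd) operator \<Rightarrow> (complex ^ 'd) operator"
  where "PsiS \<equiv> Psi S ip mult_coord"

definition defect :: "(complex ^ 'd) operator"
  where "defect f = f - PsiS id f"

text \<open>The span makes this a subspace without an appeal to linearity of \<open>defect\<close>,
  which would go through the adjoints.\<close>

definition defect_space :: "(complex ^ 'd \<Rightarrow> complex) set"
  where "defect_space = fun_space.span (defect ` S)"

lemma mult_coord_mem: "f \<in> S \<Longrightarrow> mult_coord i f \<in> S"
  using bounded[of i] by (auto simp: bounded_operator_def)

lemma shift_adj_mem: "f \<in> S \<Longrightarrow> shift_adj i f \<in> S"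
  by (rule S.adjoint_op_mem[OF bounded])

lemma Psi_power_Suc:
  "(PsiS ^^ Suc n) id f = (\<Sum>i\<in>UNIV. mult_coord i ((PsiS ^^ n) id (shift_adj i f)))"
  by (simp add: Psi_def[of _ _ _ "(PsiS ^^ n) id"])

lemma Psi_power_mem: "f \<in> S \<Longrightarrow> (PsiS ^^ n) id f \<in> S"
proof (induction n arbitrary: f)
  case (Suc n)
  then show ?case
    unfolding Psi_power_Suc by (intro S.sum_mem mult_coord_mem Suc.IH shift_adj_mem)
qed simp

lemma defect_mem: "f \<in> S \<Longrightarrow> defect f \<in> S"
  using Psi_power_mem[of f 1] by (auto simp: defect_def)

text \<open>I - Psi^(n+1)(I) = D + Psi(I - Psi^n(I)), and the outer Psi multiplies by one more
  coordinate. The induction is over all f because the hypothesis is used at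
  \<open>shift_adj i f\<close>.\<close>

lemma range_Psi_power:
  assumes "f \<in> S"
  shows "f - (PsiS ^^ n) id f \<in> fun_space.span
    (\<Union>a\<in>exponents_below n. mult_monomial a ` defect_space)" (is "_ \<in> fun_space.span (?W n)")
  using assms
proof (induction n arbitrary: f)
  case 0
  have "f - (PsiS ^^ 0) id f = 0"
    by (simp add: fun_eq_iff)
  then show ?case
    by (metis fun_space.span_zero)
next
  case (Suc n)
  let ?Y = "(PsiS ^^ n) id"
  have eq: "f - (PsiS ^^ Suc n) id f
      = defect f + (\<Sum>i\<in>UNIV. mult_coord i (shift_adj i f - ?Y (shift_adj i f)))"
    unfolding Psi_power_Suc
    by (simp only: defect_def Psi_def id_apply mult_coord_diff sum_subtractf) (simp add: fun_eq_iff)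
  have D: "defect f \<in> fun_space.span (?W (Suc n))"
  proof -
    have "mult_monomial (\<lambda>_. 0) (defect f) \<in> ?W (Suc n)"
      unfolding exponents_below_def defect_space_def
      by (intro UN_I[of "\<lambda>_. 0"] imageI fun_space.span_base Suc.prems) simp
    then show ?thesis
      by (simp add: mult_monomial_def fun_space.span_base)
  qed
  have M: "mult_coord i g \<in> fun_space.span (?W (Suc n))" if "g \<in> fun_space.span (?W n)" for i g
  proof (rule fun_space_linear_span[OF mult_coord_add mult_coord_cscale _ that])
    fix h assume "h \<in> ?W n"
    then obtain a e where a: "sum a UNIV < n" "e \<in> defect_space" "h = mult_monomial a e"
      by (auto simp: exponents_below_def)
    have "sum (\<lambda>k. a k + (if k = i then 1 else 0)) UNIV < Suc n"
      using a(1) by (simp add: sum.distrib)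
    then have "mult_coord i h \<in> ?W (Suc n)"
      using a(2) unfolding a(3) mult_coord_mult_monomial exponents_below_def by blast
    then show "mult_coord i h \<in> fun_space.span (?W (Suc n))"
      by (rule fun_space.span_base)
  qed
  show ?case
    unfolding eq
    by (intro fun_space.span_add fun_space.span_sum D M Suc.IH shift_adj_mem Suc.prems)
qed

text \<open>Extend P to a basis B of the defect space. The products of monomials of degree below n
  with members of B span the range of I - Psi^n(I), and their number is at most the dimension that
  maximality demands. A nontrivial relation makes one of them redundant, so the dimension falls
  short.\<close>

lemma maximal_imp_module_independent:
  assumes max: "maximal_tuple S ip (mult_coord :: 'd \<Rightarrow> _)"
    and P: "P \<subseteq> defect_space" "fun_space.independent P"
    and rel: "\<And>z. (\<Sum>a\<in>exponents_below n. \<Sum>p\<in>P. c a p * monomial a z * p z) = 0"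
    and mem: "a0 \<in> exponents_below n" "p0 \<in> P"
  shows "c a0 p0 = 0"
proof (rule ccontr)
  assume c0: "c a0 p0 \<noteq> 0"
  define V where "V = hclosure S ip (defect ` S)"
  define N where "N = (\<Sum>k<n. (k + CARD('d) - 1) choose (CARD('d) - 1))"
  have Delta_1: "Delta S ip (mult_coord :: 'd \<Rightarrow> _) 1 = edim V"
    by (simp add: Delta_def V_def defect_def[abs_def])
  have "n \<ge> 1"
    using mem(1) by (auto simp: exponents_below_def)
  then have Delta_n: "Delta S ip (mult_coord :: 'd \<Rightarrow> _) n = enat N * edim V"
    using max unfolding maximal_tuple_def N_def Delta_1[symmetric] by blast
  have Vfin: "edim V < \<infinity>"
    using max unfolding maximal_tuple_def Delta_1[symmetric] by blast
  obtain C where C: "finite C" "V \<subseteq> fun_space.span C" "edim V = enat (card C)"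
    by (rule edim_finite_basis[OF Vfin])
  have "defect ` S \<subseteq> V"
  proof
    fix g assume g: "g \<in> defect ` S"
    then have "g \<in> S" "(\<lambda>_::nat. hnorm ip (g - g)) \<longlonglongrightarrow> 0"
      using defect_mem by (auto simp: hnorm_def)
    then show "g \<in> V"
      unfolding V_def hclosure_def using g by (auto intro!: exI[of _ "\<lambda>_. g"])
  qed
  then have space_C: "defect_space \<subseteq> fun_space.span C"
    unfolding defect_space_def using C(2)
    by (meson fun_space.span_minimal fun_space.subspace_span order_trans)
  \<comment> \<open>B is a basis of the unclosed defect space, C one of the closure of the range. B
    is no larger than C, which is the direction the count needs.\<close>
  obtain B where B: "P \<subseteq> B" "B \<subseteq> defect_space" "fun_space.independent B"
      "defect_space \<subseteq> fun_space.span B"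
    using fun_space.maximal_independent_subset_extend[OF P] by metis
  have finB: "finite B" "card B \<le> card C"
    using fun_space.independent_span_bound[OF C(1) B(3)] B(2) space_C by auto
  define I where "I = (exponents_below n :: ('d \<Rightarrow> nat) set) \<times> B"
  define v where "v = (\<lambda>(a :: 'd \<Rightarrow> nat, b). mult_monomial a b)"
  \<comment> \<open>The given relation, with coefficient 0 at the basis vectors outside P.\<close>
  define k where "k = (\<lambda>(a, b). if b \<in> P then c a b else 0)"
  have finI: "finite I"
    using finB by (simp add: I_def)
  have i0: "(a0, p0) \<in> I" "k (a0, p0) \<noteq> 0"
    using mem B(1) c0 by (auto simp: I_def k_def)
  have rel': "(\<Sum>i\<in>I. cscale (k i) (v i)) = 0"
  proof
    fix z
    have "(\<Sum>i\<in>I. cscale (k i) (v i)) z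
        = (\<Sum>a\<in>exponents_below n. \<Sum>b\<in>B. (if b \<in> P then c a b else 0) * (monomial a z * b z))"
      by (simp add: sum_fun_apply cscale_apply I_def sum.cartesian_product k_def v_def mult_monomial_def
          case_prod_beta)
    also have "\<dots> = (\<Sum>a\<in>exponents_below n. \<Sum>p\<in>P. c a p * monomial a z * p z)"
      using B(1) finB(1) by (intro sum.cong refl sum.mono_neutral_cong_right) (auto simp: mult_ac)
    finally show "(\<Sum>i\<in>I. cscale (k i) (v i)) z = 0 z"
      using rel by simp
  qed
  let ?R = "(\<lambda>f. f - (PsiS ^^ n) id f) ` S"
  have "mult_monomial a e \<in> fun_space.span (v ` I)" if "a \<in> exponents_below n" "e \<in> defect_space" for a e
  proof (rule fun_space_linear_span[where L = "mult_monomial a" and A = B])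
    show "mult_monomial a b \<in> fun_space.span (v ` I)" if "b \<in> B" for b
      using that \<open>a \<in> _\<close> by (intro fun_space.span_base) (auto simp: I_def v_def intro!: image_eqI[of _ _ "(a, b)"])
    show "e \<in> fun_space.span B"
      using that B(4) by blast
  qed (simp_all add: mult_monomial_def cscale_def fun_eq_iff algebra_simps)
  then have "fun_space.span (\<Union>a\<in>exponents_below n. mult_monomial a ` defect_space) \<subseteq> fun_space.span (v ` I)"
    by (intro fun_space.span_minimal fun_space.subspace_span) auto
  also have "\<dots> \<subseteq> fun_space.span (v ` (I - {(a0, p0)}))"
    using span_image_remove_dependent[OF finI i0(1) rel' i0(2)] .
  finally have "?R \<subseteq> fun_space.span (v ` (I - {(a0, p0)}))"
    using range_Psi_power by blast
  then have "hclosure S ip ?R \<subseteq> fun_space.span (v ` (I - {(a0, p0)}))"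
    using S_subset Psi_power_mem finI by (intro hclosure_subset_finite_span) auto
  then have "Delta S ip (mult_coord :: 'd \<Rightarrow> _) n \<le> enat (card (v ` (I - {(a0, p0)})))"
    unfolding Delta_def using finI by (intro edim_le_card) auto
  moreover have "card (v ` (I - {(a0, p0)})) < card I"
    using card_image_le[of "I - {(a0, p0)}" v] finI i0(1)
    by (meson card_Diff1_less finite_Diff le_less_trans)
  moreover have "card I \<le> N * card C"
    unfolding I_def N_def card_cartesian_product using card_exponents_below_le finB(2) by (intro mult_mono) auto
  ultimately show False
    using Delta_n C(3) by simp
qed

end

section \<open>Homogeneous components in the Drury-Arveson space\<close>

definition hprod :: "complex ^ 'd::finite \<Rightarrow> complex ^ 'd \<Rightarrow> complex"
  where "hprod z w = (\<Sum>j\<in>UNIV. z $ j * cnj (w $ j))"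

definition hprod_power :: "complex ^ 'd::finite \<Rightarrow> nat \<Rightarrow> complex ^ 'd \<Rightarrow> complex"
  where "hprod_power w n = on_set (ball 0 1) (\<lambda>z. hprod z w ^ n)"

text \<open>Dilation factors in (0,1], so that dilated points stay in the ball. One fixed sequence
  suffices for all limits s -> 0 and fits the sequential form of \<open>complete\<close>.\<close>

definition scales :: "nat \<Rightarrow> real"
  where "scales N = inverse (real (Suc N))"

lemma scales: "0 < scales N" "scales N \<le> 1" "scales \<longlonglongrightarrow> 0"
  using LIMSEQ_inverse_real_of_nat by (auto simp: scales_def[abs_def] field_simps)

lemma of_real_scales_tendsto: "(\<lambda>N. complex_of_real (scales N)) \<longlonglongrightarrow> 0"
  using tendsto_of_real[OF scales(3), where 'a = complex] by simp

text \<open>If \<open>\<phi>\<close> lists the values of a power series along the null sequence \<open>scales\<close>, then its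
  coefficients of degree below \<open>K\<close> are \<open>c\<close>.\<close>

definition taylor_coeffs :: "(nat \<Rightarrow> complex) \<Rightarrow> (nat \<Rightarrow> complex) \<Rightarrow> nat \<Rightarrow> bool"
  where "taylor_coeffs \<phi> c K \<longleftrightarrow> (\<forall>k<K. (\<lambda>N. (\<phi> N - (\<Sum>j<k. of_real (scales N) ^ j * c j)) / of_real (scales N) ^ k) \<longlonglongrightarrow> c k)"

lemma taylor_coeffs_Suc:
  "taylor_coeffs \<phi> c (Suc K) \<longleftrightarrow> taylor_coeffs \<phi> c K \<and>
    (\<lambda>N. (\<phi> N - (\<Sum>j<K. of_real (scales N) ^ j * c j)) / of_real (scales N) ^ K) \<longlonglongrightarrow> c K"
  unfolding taylor_coeffs_def less_Suc_eq by blast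

text \<open>Once the coefficients below k are zero, the k-th quotient is s^(m-k) g, and this tends
  to 0 because g converges.\<close>

lemma taylor_coeffs_low:
  assumes "taylor_coeffs \<phi> c K" and \<phi>: "\<And>N. \<phi> N = of_real (scales N) ^ m * g N" and g: "g \<longlonglongrightarrow> L"
    and "k < K" "k < m"
  shows "c k = 0"
  using assms(4,5)
proof (induction k rule: less_induct)
  case (less k)
  have s: "complex_of_real (scales N) \<noteq> 0" for N
    using scales(1)[of N] by simp
  have sum: "(\<Sum>j<k. of_real (scales N) ^ j * c j) = 0" for N
    using less by (intro sum.neutral) auto
  have "(\<lambda>N. (\<phi> N - (\<Sum>j<k. of_real (scales N) ^ j * c j)) / of_real (scales N) ^ k) \<longlonglongrightarrow> c k"
    using assms(1) less.prems unfolding taylor_coeffs_def by blast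
  then have "(\<lambda>N. \<phi> N / of_real (scales N) ^ k) \<longlonglongrightarrow> c k"
    unfolding sum diff_zero .
  moreover have "\<phi> N / of_real (scales N) ^ k = of_real (scales N) ^ (m - k) * g N" for N
    using s less.prems by (simp add: \<phi> power_diff)
  moreover have "(\<lambda>N. of_real (scales N) ^ (m - k) * g N) \<longlonglongrightarrow> 0 ^ (m - k) * L"
    by (intro tendsto_intros of_real_scales_tendsto g)
  moreover have "(0::complex) ^ (m - k) = 0"
    using less.prems by simp
  ultimately show ?case
    using LIMSEQ_unique by fastforce
qed

text \<open>Below order m the previous lemma applies, at order m the quotient is constantly L, and
  above m the subtracted sum is all of \<phi>.\<close>

lemma taylor_coeffs_homogeneous:
  assumes "taylor_coeffs \<phi> c K" and \<phi>: "\<And>N. \<phi> N = of_real (scales N) ^ m * L" and "k < K"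
  shows "c k = (if k = m then L else 0)"
  using assms(3)
proof (induction k rule: less_induct)
  case (less k)
  have s: "complex_of_real (scales N) \<noteq> 0" for N
    using scales(1)[of N] by simp
  have "(\<Sum>j<k. of_real (scales N) ^ j * c j) = (\<Sum>j<k. if j = m then of_real (scales N) ^ m * L else 0)" for N
    using less by (intro sum.cong) auto
  then have sum: "(\<Sum>j<k. of_real (scales N) ^ j * c j) = (if m < k then \<phi> N else 0)" for N
    by (simp add: \<phi>)
  have "(\<lambda>N. (\<phi> N - (\<Sum>j<k. of_real (scales N) ^ j * c j)) / of_real (scales N) ^ k) \<longlonglongrightarrow> c k"
    using assms(1) less.prems unfolding taylor_coeffs_def by blast
  then have lim: "(\<lambda>N. (\<phi> N - (if m < k then \<phi> N else 0)) / of_real (scales N) ^ k) \<longlonglongrightarrow> c k"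
    unfolding sum .
  consider "k < m" | "k = m" | "m < k"
    by linarith
  then show ?case
  proof cases
    case 1
    then show ?thesis
      using taylor_coeffs_low[OF assms(1) \<phi> tendsto_const less.prems 1] by simp
  next
    case 2
    then have "(\<lambda>N. L) \<longlonglongrightarrow> c k"
      using lim s by (simp add: \<phi>)
    then show ?thesis
      using 2 LIMSEQ_unique[OF _ tendsto_const] by auto
  next
    case 3
    then have "(\<lambda>N::nat. 0) \<longlonglongrightarrow> c k"
      using lim by simp
    then show ?thesis
      using 3 LIMSEQ_unique[OF _ tendsto_const] by auto
  qed
qed

text \<open>The quotient of s b \<phi> at order l + 1 is b times that of \<phi> at order l.
  \<open>0 < K\<close> makes \<phi> itself converge, which gives \<open>d 0 = 0\<close>.\<close>

lemma taylor_coeffs_shift: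
  assumes c: "taylor_coeffs \<phi> c K" and d: "taylor_coeffs (\<lambda>N. of_real (scales N) * b * \<phi> N) d (Suc K)"
    and "k \<le> K" "0 < K"
  shows "d k = (case k of 0 \<Rightarrow> 0 | Suc j \<Rightarrow> b * c j)"
  using assms(3)
proof (induction k rule: less_induct)
  case (less k)
  have s: "complex_of_real (scales N) \<noteq> 0" for N
    using scales(1)[of N] by simp
  have lim: "(\<lambda>N. (of_real (scales N) * b * \<phi> N - (\<Sum>j<k. of_real (scales N) ^ j * d j)) / of_real (scales N) ^ k)
      \<longlonglongrightarrow> d k"
    using d less.prems unfolding taylor_coeffs_def by simp
  have clim: "j < K \<Longrightarrow> (\<lambda>N. (\<phi> N - (\<Sum>i<j. of_real (scales N) ^ i * c i)) / of_real (scales N) ^ j) \<longlonglongrightarrow> c j" for j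
    using c unfolding taylor_coeffs_def by blast
  show ?case
  proof (cases k)
    case 0
    have "(\<lambda>N. of_real (scales N) * b * \<phi> N) \<longlonglongrightarrow> 0 * b * c 0"
      using clim[of 0] \<open>0 < K\<close> by (intro tendsto_intros of_real_scales_tendsto) simp
    then show ?thesis
      using 0 lim LIMSEQ_unique by fastforce
  next
    case (Suc l)
    have "(\<Sum>j<k. of_real (scales N) ^ j * d j) = of_real (scales N) * b * (\<Sum>j<l. of_real (scales N) ^ j * c j)" for N
    proof -
      have "(\<Sum>j<k. of_real (scales N) ^ j * d j) = d 0 + (\<Sum>j<l. of_real (scales N) ^ Suc j * d (Suc j))"
        unfolding Suc sum.lessThan_Suc_shift by simp
      also have "d 0 = 0"
        using less.IH[of 0] Suc by simp
      also have "(\<Sum>j<l. of_real (scales N) ^ Suc j * d (Suc j)) = (\<Sum>j<l. of_real (scales N) * b * (of_real (scales N) ^ j * c j))"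
        using less.IH less.prems Suc by (intro sum.cong) auto
      finally show ?thesis
        by (simp add: sum_distrib_left)
    qed
    then have "(of_real (scales N) * b * \<phi> N - (\<Sum>j<k. of_real (scales N) ^ j * d j)) / of_real (scales N) ^ k
        = b * ((\<phi> N - (\<Sum>j<l. of_real (scales N) ^ j * c j)) / of_real (scales N) ^ l)" for N
      using s[of N] by (simp add: Suc field_simps)
    moreover have "(\<lambda>N. b * ((\<phi> N - (\<Sum>j<l. of_real (scales N) ^ j * c j)) / of_real (scales N) ^ l)) \<longlonglongrightarrow> b * c l"
      using Suc less.prems by (intro tendsto_intros clim) simp
    ultimately show ?thesis
      using lim LIMSEQ_unique Suc by auto
  qed
qed

lemma hprod_scaleR_left: "hprod (s *\<^sub>R z) w = of_real s * hprod z w"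
  and hprod_scaleR_right: "hprod z (s *\<^sub>R w) = of_real s * hprod z w"
  by (simp_all add: hprod_def sum_distrib_left scaleR_conv_of_real[where 'a = complex] mult_ac)

lemma cmod_hprod_le: "cmod (hprod z w) \<le> norm z * norm w"
proof -
  have "cmod (hprod z w) \<le> (\<Sum>j\<in>UNIV. \<bar>norm (z $ j)\<bar> * \<bar>norm (w $ j)\<bar>)"
    unfolding hprod_def by (rule norm_sum[THEN order_trans]) (simp add: norm_mult)
  also have "\<dots> \<le> norm z * norm w"
    unfolding norm_vec_def by (rule L2_set_mult_ineq)
  finally show ?thesis .
qed

lemma cmod_hprod_less:
  assumes "norm z < 1" "norm w < 1"
  shows "cmod (hprod z w) < 1"
  using cmod_hprod_le[of z w] assms mult_left_le[of "norm w" "norm z"] by simp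

lemma cmod_hprod_scaled_less:
  assumes "norm z < 1" "norm w < 1" "0 \<le> s" "s \<le> 1"
  shows "cmod (of_real s * hprod z w) < 1"
  using cmod_hprod_less[OF assms(1,2)] assms(3,4) mult_le_one[of s "cmod (hprod z w)"]
  by (smt (verit) mult_left_le_one_le norm_ge_zero norm_mult norm_of_real)

lemma scaled_in_ball: "norm w < 1 \<Longrightarrow> 0 \<le> s \<Longrightarrow> s \<le> 1 \<Longrightarrow> norm (s *\<^sub>R w) < 1"
  by (smt (verit) mult_left_le_one_le norm_ge_zero norm_scaleR)

lemma inverse_minus_partial_geometric:
  assumes "x \<noteq> (1::complex)"
  shows "inverse (1 - x) - (\<Sum>j<n. x ^ j) = x ^ n / (1 - x)"
  using assms by (simp add: sum_gp_strict divide_simps)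

section \<open>Powers of the pairing as elements of H\<close>

context drury_arveson
begin

definition kern :: "complex ^ 'd \<Rightarrow> complex ^ 'd \<Rightarrow> complex"
  where "kern w = on_set (ball 0 1) (DA_kernel w)"

lemma kernel_in: "norm w < 1 \<Longrightarrow> kern w \<in> H"
  using kernel_mem[of w] by (simp add: kern_def)

lemma ip_kernel: "f \<in> H \<Longrightarrow> norm w < 1 \<Longrightarrow> ip f (kern w) = f w"
  using reproducing[of f w] by (simp add: kern_def)

lemma kernel_apply: "norm z < 1 \<Longrightarrow> kern w z = inverse (1 - hprod z w)"
  by (simp add: kern_def on_set_def DA_kernel_def hprod_def)

lemma vanishes_outside: "f \<in> H \<Longrightarrow> \<not> norm z < 1 \<Longrightarrow> f z = 0"
  using fun_cong[OF on_X[of f], of z] by (simp add: on_set_def)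

lemma eqI_ball: "f \<in> H \<Longrightarrow> g \<in> H \<Longrightarrow> (\<And>z. norm z < 1 \<Longrightarrow> f z = g z) \<Longrightarrow> f = g"
  using vanishes_outside by (metis ext)

lemma hprod_power_apply: "norm z < 1 \<Longrightarrow> hprod_power w n z = hprod z w ^ n"
  by (simp add: hprod_power_def on_set_def)

lemma hprod_power_outside: "\<not> norm z < 1 \<Longrightarrow> hprod_power w n z = 0"
  by (simp add: hprod_power_def on_set_def)

text \<open>\<open>hprod_power w n\<close> is the \<open>n\<close>-th coefficient of \<open>s \<mapsto> kern (s w)\<close> at \<open>0\<close>. It is obtained as
  the limit of the remainders \<open>h s = s\<^sup>-\<^sup>n (kern (s w) - \<Sum>j<n. s\<^sup>j hprod_power w j)\<close>, which satisfy
  \<open>ip (h s) (h t) = a\<^sup>n / (1 - s t a)\<close> with \<open>a = hprod w w\<close>.\<close>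

lemma hprod_power_aux:
  assumes w: "norm w < 1"
  shows "hprod_power w n \<in> H \<and>
    (\<forall>f\<in>H. taylor_coeffs (\<lambda>N. f (scales N *\<^sub>R w)) (\<lambda>k. ip f (hprod_power w k)) (Suc n))"
proof (induction n rule: less_induct)
  case (less n)
  let ?u = "hprod_power w"
  define a where "a = hprod w w"
  have uH: "?u k \<in> H" if "k < n" for k
    using less that by blast
  have coeffs: "taylor_coeffs (\<lambda>N. f (scales N *\<^sub>R w)) (\<lambda>k. ip f (?u k)) n" if "f \<in> H" for f
    using less that unfolding taylor_coeffs_def by blast
  define h where "h s = cscale (inverse (of_real s ^ n))
      (kern (s *\<^sub>R w) - (\<Sum>j<n. cscale (of_real s ^ j) (?u j)))" for s
  have sumH: "(\<Sum>j<n. cscale (of_real s ^ j) (?u j)) \<in> H" for s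
    using uH by (intro sum_mem scale_mem) auto
  have kH: "kern (s *\<^sub>R w) \<in> H" if "0 \<le> s" "s \<le> 1" for s
    by (intro kernel_in scaled_in_ball w that)
  have hH: "h s \<in> H" if "0 < s" "s \<le> 1" for s
    unfolding h_def using that by (intro scale_mem diff_mem kH sumH) auto
  have h_apply: "h s z = hprod z w ^ n / (1 - of_real s * hprod z w)"
    if "0 < s" "s \<le> 1" "norm z < 1" for s z
  proof -
    have "of_real s * hprod z w \<noteq> 1"
      using cmod_hprod_scaled_less[OF that(3) w, of s] that by auto
    from inverse_minus_partial_geometric[OF this, of n]
    have "h s z = inverse (of_real s ^ n) * ((of_real s * hprod z w) ^ n / (1 - of_real s * hprod z w))"
      using that by (simp add: h_def cscale_apply sum_fun_apply kernel_apply hprod_scaleR_right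
          hprod_power_apply power_mult_distrib)
    then show ?thesis
      using that by (simp add: power_mult_distrib)
  qed
  have ip_h: "ip f (h t) = (f (t *\<^sub>R w) - (\<Sum>j<n. of_real t ^ j * ip f (?u j))) / of_real t ^ n"
    if "f \<in> H" "0 < t" "t \<le> 1" for f t
  proof -
    have "ip f (\<Sum>j<n. cscale (of_real t ^ j) (?u j)) = (\<Sum>j<n. of_real t ^ j * ip f (?u j))"
      using that uH by (subst ip_sum_right) (auto simp: ip_scale_right intro: scale_mem)
    moreover have "norm (t *\<^sub>R w) < 1"
      using that w by (intro scaled_in_ball) auto
    moreover have "ip f (h t) = cnj (inverse (of_real t ^ n))
        * ip f (kern (t *\<^sub>R w) - (\<Sum>j<n. cscale (of_real t ^ j) (?u j)))"
      unfolding h_def using that by (intro ip_scale_right diff_mem kH sumH) auto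
    ultimately show ?thesis
      using that kH sumH by (simp add: ip_diff_right ip_kernel divide_inverse mult.commute)
  qed
  have lim_denom: "(\<lambda>N. x ^ n / (1 - of_real (scales N) * (b * x))) \<longlonglongrightarrow> x ^ n" for x b :: complex
  proof -
    have "(\<lambda>N. x ^ n / (1 - of_real (scales N) * (b * x))) \<longlonglongrightarrow> x ^ n / (1 - 0 * (b * x))"
      by (intro tendsto_intros of_real_scales_tendsto) simp
    then show ?thesis by simp
  qed
  \<comment> \<open>Along the ray through w the function \<open>h s\<close> has order n, so its
    coefficients below n vanish; by induction these are its inner products with the lower
    powers.\<close>
  have ip_h_u: "ip (h s) (?u k) = 0" if s: "0 < s" "s \<le> 1" and k: "k < n" for s k
  proof (rule taylor_coeffs_low[OF coeffs[OF hH[OF s]] _ lim_denom[of a "of_real s"] k k])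
    fix N
    have t: "norm (scales N *\<^sub>R w) < 1"
      using scales w less_imp_le by (intro scaled_in_ball) auto
    show "h s (scales N *\<^sub>R w) = of_real (scales N) ^ n * (a ^ n / (1 - of_real (scales N) * (of_real s * a)))"
      by (simp add: h_apply[OF s t] hprod_scaleR_left a_def power_mult_distrib mult_ac)
  qed
  have ip_h_h: "ip (h s) (h t) = a ^ n / (1 - of_real (s * t) * a)"
    if s: "0 < s" "s \<le> 1" and t: "0 < t" "t \<le> 1" for s t
  proof -
    have tw: "norm (t *\<^sub>R w) < 1"
      using t w by (intro scaled_in_ball) auto
    have "ip (h s) (h t) = h s (t *\<^sub>R w) / of_real t ^ n"
      using ip_h[OF hH[OF s] t] ip_h_u[OF s] by simp
    then show ?thesis
      using t by (simp add: h_apply[OF s tw] hprod_scaleR_left a_def power_mult_distrib mult_ac)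
  qed
  \<comment> \<open>The inner products depend only on the product s t, so the squared distance of
    two remainders is F(s^2) - 2 F(s t) + F(t^2), which is small by continuity of F at 0.\<close>
  define F where "F s = Re (a ^ n / (1 - of_real s * a))" for s :: real
  have F0: "isCont F 0"
    unfolding F_def isCont_def by (rule tendsto_eq_intros refl | simp)+
  have "\<forall>e>0. \<exists>N. \<forall>i\<ge>N. \<forall>j\<ge>N. hnorm ip (h (scales i) - h (scales j)) < e"
  proof (intro allI impI)
    fix e :: real assume e: "e > 0"
    then obtain \<delta> where \<delta>: "\<delta> > 0" "\<And>s. \<bar>s\<bar> < \<delta> \<Longrightarrow> \<bar>F s - F 0\<bar> < e\<^sup>2 / 4"
      using F0[unfolded continuous_at_eps_delta, rule_format, of "e\<^sup>2 / 4"]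
      by (auto simp: dist_real_def)
    obtain N where N: "\<And>i. i \<ge> N \<Longrightarrow> scales i < \<delta>"
      using order_tendstoD(2)[OF scales(3) \<delta>(1)] by (auto simp: eventually_sequentially)
    have "hnorm ip (h (scales i) - h (scales j)) < e" if "i \<ge> N" "j \<ge> N" for i j
    proof -
      have small: "\<bar>F (scales p * scales q) - F 0\<bar> < e\<^sup>2 / 4" if "p \<ge> N" for p q
      proof (rule \<delta>(2))
        have "scales p * scales q \<le> scales p"
          using scales(1)[of p] scales(2)[of q] by simp
        moreover have "0 < scales p * scales q"
          by (intro mult_pos_pos scales)
        ultimately show "\<bar>scales p * scales q\<bar> < \<delta>"
          using N[OF that] by linarith
      qed
      have "(hnorm ip (h (scales i) - h (scales j)))\<^sup>2
          = F (scales i * scales i) - 2 * F (scales i * scales j) + F (scales j * scales j)"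
        using hH scales by (simp add: hnorm_squared diff_mem Re_ip_diff_self ip_h_h F_def)
      moreover have "p - 2 * q + r < y" if "\<bar>p - x\<bar> < y / 4" "\<bar>q - x\<bar> < y / 4" "\<bar>r - x\<bar> < y / 4"
        for p q r x y :: real
        using that by (simp add: abs_if split: if_splits)
      ultimately have "(hnorm ip (h (scales i) - h (scales j)))\<^sup>2 < e\<^sup>2"
        using small[OF that(1)] small[OF that(2)] by metis
      then show ?thesis
        using e by (meson less_imp_le power2_less_imp_less)
    qed
    then show "\<exists>N. \<forall>i\<ge>N. \<forall>j\<ge>N. hnorm ip (h (scales i) - h (scales j)) < e"
      by blast
  qed
  then obtain l where l: "l \<in> H" "(\<lambda>N. hnorm ip (h (scales N) - l)) \<longlonglongrightarrow> 0"
    using complete[of "\<lambda>N. h (scales N)"] hH scales by blast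
  \<comment> \<open>The norm limit is identified by its values: h s z tends to <z, w>^n as s ->
    0.\<close>
  have "l = ?u n"
  proof
    fix z
    show "l z = ?u n z"
    proof (cases "norm z < 1")
      case True
      have "(\<lambda>N. h (scales N) z) \<longlonglongrightarrow> l z"
        using hH scales l by (intro tendsto_pointwise) auto
      moreover have "(\<lambda>N. h (scales N) z) \<longlonglongrightarrow> hprod z w ^ n"
        using lim_denom[of "hprod z w" 1] by (simp add: h_apply scales True)
      ultimately show ?thesis
        using LIMSEQ_unique hprod_power_apply[OF True] by metis
    next
      case False
      then show ?thesis
        using vanishes_outside[OF l(1)] hprod_power_outside by metis
    qed
  qed
  then have u: "?u n \<in> H" "(\<lambda>N. hnorm ip (h (scales N) - ?u n)) \<longlonglongrightarrow> 0"
    using l by auto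
  have "taylor_coeffs (\<lambda>N. f (scales N *\<^sub>R w)) (\<lambda>k. ip f (?u k)) (Suc n)" if f: "f \<in> H" for f
  proof -
    have "(\<lambda>N. ip f (h (scales N))) \<longlonglongrightarrow> ip f (?u n)"
      using hH scales u f by (intro tendsto_ip_right) auto
    then show ?thesis
      using coeffs[OF f] unfolding taylor_coeffs_Suc ip_h[OF f scales(1,2)] by blast
  qed
  then show ?case
    using u(1) by blast
qed

lemma hprod_power_mem: "norm w < 1 \<Longrightarrow> hprod_power w n \<in> H"
  using hprod_power_aux by blast

lemma taylor_coeffs_ip:
  "norm w < 1 \<Longrightarrow> f \<in> H \<Longrightarrow> taylor_coeffs (\<lambda>N. f (scales N *\<^sub>R w)) (\<lambda>k. ip f (hprod_power w k)) K"
  using hprod_power_aux[of w K] unfolding taylor_coeffs_def by simp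

text \<open>Along the ray f is a single power of s. Hence \<open>hprod_power w m\<close> acts as a
  reproducing vector on homogeneous functions of degree m and annihilates the other degrees.\<close>

lemma ip_hprod_power_homogeneous:
  assumes "norm w < 1" "f \<in> H"
    and "\<And>s. 0 \<le> s \<Longrightarrow> s \<le> 1 \<Longrightarrow> f (s *\<^sub>R w) = of_real s ^ m * f w"
  shows "ip f (hprod_power w n) = (if n = m then f w else 0)"
  using scales by (intro taylor_coeffs_homogeneous[OF taylor_coeffs_ip[OF assms(1,2), of "Suc n"]] assms(3))
    (auto intro: less_imp_le)

text \<open>The adjoint of multiplication by z_i on the powers, read off from the factor s w_i that
  the multiplication contributes along the ray. Membership of \<open>mult_coord i f\<close> in H is
  a premise here; for f in S it follows from invariance.\<close>

lemma
  assumes "norm w < 1" "f \<in> H" "mult_coord i f \<in> H"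
  shows ip_mult_coord_hprod_power_0: "ip (mult_coord i f) (hprod_power w 0) = 0"
    and ip_mult_coord_hprod_power_Suc:
      "ip (mult_coord i f) (hprod_power w (Suc n)) = w $ i * ip f (hprod_power w n)"
proof -
  have "mult_coord i f (s *\<^sub>R w) = of_real s * w $ i * f (s *\<^sub>R w)" for s
    by (simp add: mult_coord_def scaleR_conv_of_real[where 'a = complex])
  then have "taylor_coeffs (\<lambda>N. of_real (scales N) * w $ i * f (scales N *\<^sub>R w))
      (\<lambda>k. ip (mult_coord i f) (hprod_power w k)) K" for K
    using taylor_coeffs_ip[OF assms(1,3)] by simp
  note shift = taylor_coeffs_shift[OF taylor_coeffs_ip[OF assms(1,2)] this]
  show "ip (mult_coord i f) (hprod_power w 0) = 0"
    using shift[of 0 1] by simp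
  show "ip (mult_coord i f) (hprod_power w (Suc n)) = w $ i * ip f (hprod_power w n)"
    using shift[of "Suc n" "Suc n"] by simp
qed

text \<open>The partial sums of the powers converge in norm to the kernel function at w: their
  squared distance to it is a tail of a geometric series in a = <w, w>. So orthogonality to all
  powers passes to the kernel.\<close>

lemma eq_0_if_orthogonal_hprod_power:
  assumes w: "norm w < 1" and f: "f \<in> H" and orth: "\<And>n. ip f (hprod_power w n) = 0"
  shows "f w = 0"
proof -
  define a where "a = hprod w w"
  have a: "cmod a < 1"
    using cmod_hprod_less[OF w w] by (simp add: a_def)
  let ?u = "hprod_power w"
  have u: "?u n \<in> H" for n
    using hprod_power_mem[OF w] .
  have ip_u: "ip (?u m) (?u n) = (if n = m then a ^ m else 0)" for m n
  proof (subst ip_hprod_power_homogeneous[OF w u, of m m])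
    fix s :: real assume "0 \<le> s" "s \<le> 1"
    then show "?u m (s *\<^sub>R w) = of_real s ^ m * ?u m w"
      using w scaled_in_ball[OF w] by (simp add: hprod_power_apply hprod_scaleR_left power_mult_distrib)
  qed (use w in \<open>auto simp: hprod_power_apply a_def\<close>)
  define g where "g N = (\<Sum>n<N. ?u n)" for N
  have g: "g N \<in> H" for N
    unfolding g_def using u by (intro sum_mem)
  have norm_sq: "(hnorm ip (g N - kern w))\<^sup>2 = Re (a ^ N / (1 - a))" for N
  proof -
    have gk: "ip (g N) (kern w) = (\<Sum>n<N. a ^ n)"
      using w u by (simp add: g_def ip_sum kernel_in ip_kernel hprod_power_apply a_def)
    have gg: "ip (g N) (g N) = (\<Sum>n<N. a ^ n)"
      using u g unfolding g_def by (simp add: ip_sum ip_sum_right sum_mem ip_u)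
    have kk: "ip (kern w) (kern w) = inverse (1 - a)"
      using w by (simp add: ip_kernel kernel_in kernel_apply a_def)
    have "(hnorm ip (g N - kern w))\<^sup>2 = Re (ip (kern w) (kern w) - (\<Sum>n<N. a ^ n))"
      using g kernel_in[OF w] by (simp add: hnorm_squared diff_mem Re_ip_diff_self gk gg)
    moreover have "inverse (1 - a) - (\<Sum>n<N. a ^ n) = a ^ N / (1 - a)"
      using a by (intro inverse_minus_partial_geometric) auto
    ultimately show ?thesis
      by (simp only: kk)
  qed
  have "(\<lambda>N. Re (a ^ N / (1 - a))) \<longlonglongrightarrow> Re (0 / (1 - a))"
    using a by (intro tendsto_intros LIMSEQ_power_zero) auto
  then have "(\<lambda>N. sqrt ((hnorm ip (g N - kern w))\<^sup>2)) \<longlonglongrightarrow> sqrt 0"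
    unfolding norm_sq by (intro tendsto_intros) simp
  then have "(\<lambda>N. hnorm ip (g N - kern w)) \<longlonglongrightarrow> 0"
    using g kernel_in[OF w] by (simp add: hnorm_nonneg diff_mem)
  then have lim: "(\<lambda>N. ip f (g N)) \<longlonglongrightarrow> ip f (kern w)"
    using g kernel_in[OF w] f by (intro tendsto_ip_right)
  have "ip f (g N) = 0" for N
    unfolding g_def using f u orth by (simp add: ip_sum_right)
  then have "ip f (kern w) = 0"
    using LIMSEQ_unique[OF lim, of 0] by simp
  then show ?thesis
    using ip_kernel[OF f w] by simp
qed

end

section \<open>Homogeneous polynomials\<close>

definition ball_monomial :: "('d::finite \<Rightarrow> nat) \<Rightarrow> complex ^ 'd \<Rightarrow> complex"
  where "ball_monomial a = on_set (ball 0 1) (monomial a)"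

lemma homogeneous_polynomial_iff:
  fixes p :: "complex ^ 'd::finite \<Rightarrow> complex"
  shows "homogeneous_polynomial m p \<longleftrightarrow>
    (\<exists>c. p = (\<Sum>a | sum a UNIV = m. cscale (c a) (ball_monomial a)))"
proof -
  have "on_set (ball 0 1) (\<lambda>z. \<Sum>a | sum a UNIV = m. c a * (\<Prod>i\<in>UNIV. (z $ i) ^ a i))
      = (\<Sum>a | sum a UNIV = m. cscale (c a) (ball_monomial a))" for c :: "('d \<Rightarrow> nat) \<Rightarrow> complex"
    by (rule ext) (simp add: on_set_def sum_fun_apply cscale_apply ball_monomial_def monomial_def)
  then show ?thesis
    unfolding homogeneous_polynomial_def by metis
qed

lemma homogeneous_polynomial_subspace: "fun_space.subspace {p. homogeneous_polynomial m p}"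
proof (rule fun_space.subspaceI)
  have "0 = (\<Sum>a | sum a UNIV = m. cscale 0 (ball_monomial a))"
    by (simp only: fun_space.scale_zero_left sum.neutral_const)
  then show "0 \<in> {p. homogeneous_polynomial m p}"
    unfolding homogeneous_polynomial_iff mem_Collect_eq by (rule exI[where x = "\<lambda>_. 0"])
next
  fix p q :: "complex ^ 'd \<Rightarrow> complex"
  assume "p \<in> {p. homogeneous_polynomial m p}" "q \<in> {p. homogeneous_polynomial m p}"
  then obtain c c' where "p = (\<Sum>a | sum a UNIV = m. cscale (c a) (ball_monomial a))"
      "q = (\<Sum>a | sum a UNIV = m. cscale (c' a) (ball_monomial a))"
    unfolding homogeneous_polynomial_iff by blast
  then have "p + q = (\<Sum>a | sum a UNIV = m. cscale (c a + c' a) (ball_monomial a))"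
    by (simp only: fun_space.scale_left_distrib sum.distrib)
  then show "p + q \<in> {p. homogeneous_polynomial m p}"
    unfolding homogeneous_polynomial_iff mem_Collect_eq by (rule exI[where x = "\<lambda>a. c a + c' a"])
next
  fix k and p :: "complex ^ 'd \<Rightarrow> complex"
  assume "p \<in> {p. homogeneous_polynomial m p}"
  then obtain c where "p = (\<Sum>a | sum a UNIV = m. cscale (c a) (ball_monomial a))"
    unfolding homogeneous_polynomial_iff by blast
  then have "cscale k p = (\<Sum>a | sum a UNIV = m. cscale (k * c a) (ball_monomial a))"
    by (simp only: fun_space.scale_sum_right fun_space.scale_scale)
  then show "cscale k p \<in> {p. homogeneous_polynomial m p}"
    unfolding homogeneous_polynomial_iff mem_Collect_eq by (rule exI[where x = "\<lambda>a. k * c a"])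
qed

lemma
  shows homogeneous_polynomial_add:
      "homogeneous_polynomial m p \<Longrightarrow> homogeneous_polynomial m q \<Longrightarrow> homogeneous_polynomial m (p + q)"
    and homogeneous_polynomial_diff:
      "homogeneous_polynomial m p \<Longrightarrow> homogeneous_polynomial m q \<Longrightarrow> homogeneous_polynomial m (p - q)"
    and homogeneous_polynomial_cscale:
      "homogeneous_polynomial m p \<Longrightarrow> homogeneous_polynomial m (cscale c p)"
    and homogeneous_polynomial_sum:
      "(\<And>i. i \<in> I \<Longrightarrow> homogeneous_polynomial m (P i)) \<Longrightarrow> homogeneous_polynomial m (sum P I)"
  using fun_space.subspace_add[OF homogeneous_polynomial_subspace]
    fun_space.subspace_diff[OF homogeneous_polynomial_subspace]
    fun_space.subspace_scale[OF homogeneous_polynomial_subspace]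
    fun_space.subspace_sum[OF homogeneous_polynomial_subspace, of I P]
  by blast+

lemma homogeneous_polynomial_ball_monomial: "homogeneous_polynomial (sum a UNIV) (ball_monomial a)"
proof -
  have "ball_monomial a = (\<Sum>b | sum b UNIV = sum a UNIV. cscale (if b = a then 1 else 0) (ball_monomial b))"
    by (intro ext) (simp add: finite_exponents sum_fun_apply cscale_apply if_distrib[of "\<lambda>x. x * _"] cong: if_cong)
  then show ?thesis
    unfolding homogeneous_polynomial_iff by (rule exI[where x = "\<lambda>b. if b = a then 1 else 0"])
qed

lemma homogeneous_polynomial_span:
  "homogeneous_polynomial m p \<longleftrightarrow> p \<in> fun_space.span (ball_monomial ` {a. sum a UNIV = m})"
proof
  assume "homogeneous_polynomial m p"
  then obtain c where "p = (\<Sum>a | sum a UNIV = m. cscale (c a) (ball_monomial a))"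
    unfolding homogeneous_polynomial_iff by blast
  moreover have "\<dots> \<in> fun_space.span (ball_monomial ` {a. sum a UNIV = m})"
    by (intro fun_space.span_sum fun_space.span_scale fun_space.span_base) auto
  ultimately show "p \<in> fun_space.span (ball_monomial ` {a. sum a UNIV = m})"
    by simp
next
  assume "p \<in> fun_space.span (ball_monomial ` {a. sum a UNIV = m})"
  moreover have "fun_space.span (ball_monomial ` {a. sum a UNIV = m}) \<subseteq> {p. homogeneous_polynomial m p}"
    by (intro fun_space.span_minimal homogeneous_polynomial_subspace)
      (auto intro: homogeneous_polynomial_ball_monomial)
  ultimately show "homogeneous_polynomial m p"
    by blast
qed

lemma homogeneous_polynomial_apply:
  assumes "p = (\<Sum>a | sum a UNIV = m. cscale (c a) (ball_monomial a))"
  shows "p z = (if norm z < 1 then \<Sum>a | sum a UNIV = m. c a * monomial a z else 0)"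
  unfolding assms by (simp add: sum_fun_apply cscale_apply ball_monomial_def on_set_def)

lemma monomial_scaleR: "monomial a (s *\<^sub>R w) = of_real s ^ sum a UNIV * monomial a w"
  by (simp add: monomial_def scaleR_conv_of_real[where 'a = complex] power_mult_distrib
      prod.distrib power_sum)

lemma homogeneous_polynomial_scaleR:
  assumes "homogeneous_polynomial m p" "norm w < 1" "0 \<le> s" "s \<le> 1"
  shows "p (s *\<^sub>R w) = of_real s ^ m * p w"
proof -
  obtain c where "p = (\<Sum>a | sum a UNIV = m. cscale (c a) (ball_monomial a))"
    using assms(1) unfolding homogeneous_polynomial_iff by blast
  note p = homogeneous_polynomial_apply[OF this]
  have "(\<Sum>a | sum a UNIV = m. c a * monomial a (s *\<^sub>R w))
      = (\<Sum>a | sum a UNIV = m. of_real s ^ m * (c a * monomial a w))"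
    by (intro sum.cong) (auto simp: monomial_scaleR)
  then show ?thesis
    unfolding p using assms(2) scaled_in_ball[OF assms(2-4)] by (simp add: sum_distrib_left)
qed

lemma homogeneous_polynomial_mult_coord:
  assumes "homogeneous_polynomial m p"
  shows "homogeneous_polynomial (Suc m) (mult_coord i p)"
  unfolding homogeneous_polynomial_span
proof (rule fun_space_linear_span[OF mult_coord_add mult_coord_cscale])
  show "p \<in> fun_space.span (ball_monomial ` {a. sum a UNIV = m})"
    using assms unfolding homogeneous_polynomial_span .
next
  fix f assume "f \<in> ball_monomial ` {a :: 'a \<Rightarrow> nat. sum a UNIV = m}"
  then obtain a where a: "f = ball_monomial a" "sum a UNIV = m"
    by blast
  have "mult_coord i f = ball_monomial (\<lambda>k. a k + (if k = i then 1 else 0))"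
    unfolding a(1) ball_monomial_def on_set_def monomial_add monomial_unit mult_coord_def
    by (simp add: fun_eq_iff)
  moreover have "sum (\<lambda>k. a k + (if k = i then 1 else 0)) UNIV = Suc m"
    using a(2) by (simp add: sum.distrib)
  ultimately show "mult_coord i f \<in> fun_space.span (ball_monomial ` {a. sum a UNIV = Suc m})"
    by (auto intro!: fun_space.span_base)
qed

text \<open>This recursion stands in for the multinomial theorem: it shows that the powers are
  polynomials, and that a submodule with the constant 1 contains all of them.\<close>

lemma hprod_power_Suc:
  "hprod_power w (Suc n) = (\<Sum>j\<in>UNIV. cscale (cnj (w $ j)) (mult_coord j (hprod_power w n)))"
  by (rule ext) (simp add: hprod_power_def on_set_def sum_fun_apply cscale_apply mult_coord_def
      hprod_def[of _ w] sum_distrib_right mult_ac)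

lemma hprod_power_0: "hprod_power w 0 = ball_monomial (\<lambda>_. 0)"
  by (simp add: hprod_power_def ball_monomial_def on_set_def fun_eq_iff)

lemma homogeneous_polynomial_hprod_power: "homogeneous_polynomial n (hprod_power w n)"
proof (induction n)
  case 0
  then show ?case
    using homogeneous_polynomial_ball_monomial[of "\<lambda>_. 0"] by (simp add: hprod_power_0)
next
  case (Suc n)
  then show ?case
    unfolding hprod_power_Suc
    by (intro homogeneous_polynomial_sum homogeneous_polynomial_cscale homogeneous_polynomial_mult_coord)
qed

text \<open>Completeness is the point: the limit exists in H and, being a pointwise limit, stays in
  the finite span.\<close>

lemma (in rkhs) hilbert_space_finite_dim_subspace:
  assumes U: "fun_space.subspace U" "U \<subseteq> H" "U \<subseteq> fun_space.span B" and "finite B"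
  shows "hilbert_space U ip"
proof unfold_locales
  obtain C where C: "C \<subseteq> U" "fun_space.independent C" "U \<subseteq> fun_space.span C"
    by (rule fun_space.basis_exists[of U])
  have finC: "finite C"
    using fun_space.independent_span_bound[OF \<open>finite B\<close> C(2)] C(1) U(3) by auto
  have UC: "U = fun_space.span C"
    using C fun_space.span_minimal[OF C(1) U(1)] by blast
  fix X :: "nat \<Rightarrow> 'x \<Rightarrow> complex"
  assume X: "\<forall>n. X n \<in> U" "\<forall>e>0. \<exists>N. \<forall>m\<ge>N. \<forall>n\<ge>N. hnorm ip (X m - X n) < e"
  have XH: "X n \<in> H" for n
    using X(1) U(2) by blast
  obtain l where l: "l \<in> H" "(\<lambda>n. hnorm ip (X n - l)) \<longlonglongrightarrow> 0"
    using complete[of X] XH X(2) by blast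
  have XC: "X n \<in> fun_space.span C" for n
    using X(1) UC by blast
  have "l \<in> U"
    unfolding UC by (rule finite_span_pointwise_closed[OF finC XC tendsto_pointwise[OF XH l]])
  then show "\<exists>l\<in>U. (\<lambda>n. hnorm ip (X n - l)) \<longlonglongrightarrow> 0"
    using l(2) by blast
qed (use U(1,2) in \<open>auto simp: ip_add ip_scale subset_iff intro: ip_commute ip_pos\<close>)

text \<open>The projection of f is the Riesz vector, taken inside U, of the functional u |-> <u,
  f>.\<close>

lemma (in hilbert_space) orthogonal_projection:
  assumes "hilbert_space U ip" "U \<subseteq> H" "f \<in> H"
  shows "\<exists>g\<in>U. \<forall>u\<in>U. ip u (f - g) = 0"
proof -
  interpret U: hilbert_space U ip
    by (rule assms(1))
  have "\<exists>g\<in>U. \<forall>u\<in>U. ip u f = ip u g"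
  proof (rule U.riesz_representation)
    show "cmod (ip u f) \<le> hnorm ip f * hnorm ip u" if "u \<in> U" for u
      using cauchy_schwarz[of u f] that assms(2,3) by (auto simp: mult.commute)
  qed (use assms(2,3) in \<open>auto simp: ip_add ip_scale subsetD\<close>)
  then show ?thesis
    using assms(2,3) by (metis diff_self ip_diff_right subsetD)
qed

lemma norm_axis: "norm (axis j t :: complex ^ 'd::finite) = norm t"
proof -
  have "(\<Sum>i\<in>UNIV. (norm (axis j t $ i))\<^sup>2) = (\<Sum>i\<in>UNIV. if i = j then (norm t)\<^sup>2 else 0)"
    by (intro sum.cong) (auto simp: axis_def)
  then show ?thesis
    by (simp add: norm_vec_def L2_set_def)
qed

section \<open>Adjoints of the coordinate multiplications on homogeneous polynomials\<close>

context drury_arveson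
begin

text \<open>Project p to the span. The difference is again homogeneous of degree m, and pairing it
  with \<open>hprod_power z m\<close> gives its value at z, so orthogonality forces it to vanish.
  Linear claims about homogeneous polynomials thereby reduce to powers.\<close>

lemma homogeneous_in_span_hprod_power:
  assumes "p \<in> H" "homogeneous_polynomial m p"
  shows "p \<in> fun_space.span ((\<lambda>w. hprod_power w m) ` {w. norm w < 1})" (is "_ \<in> ?U")
proof -
  let ?B = "ball_monomial ` {a :: 'd \<Rightarrow> nat. sum a UNIV = m}"
  have UH: "?U \<subseteq> H"
    by (intro fun_space.span_minimal subspace) (auto intro: hprod_power_mem)
  have UB: "?U \<subseteq> fun_space.span ?B"
    by (intro fun_space.span_minimal fun_space.subspace_span)
      (auto simp: homogeneous_polynomial_hprod_power homogeneous_polynomial_span[symmetric])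
  have "hilbert_space ?U ip"
    by (rule hilbert_space_finite_dim_subspace[OF fun_space.subspace_span UH UB])
      (simp add: finite_exponents)
  then obtain g where g: "g \<in> ?U" "\<And>u. u \<in> ?U \<Longrightarrow> ip u (p - g) = 0"
    using orthogonal_projection[OF _ UH assms(1)] by blast
  have gH: "g \<in> H"
    using g(1) UH by blast
  then have diff: "p - g \<in> H"
    using assms(1) by blast
  have hom: "homogeneous_polynomial m (p - g)"
    using g(1) UB assms(2) homogeneous_polynomial_span by (intro homogeneous_polynomial_diff) auto
  have "p z = g z" if z: "norm z < 1" for z
  proof -
    have uz: "hprod_power z m \<in> ?U"
      using z by (intro fun_space.span_base) auto
    have "ip (p - g) (hprod_power z m) = (p - g) z"
      using ip_hprod_power_homogeneous[OF z diff homogeneous_polynomial_scaleR[OF hom z], of m]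
      by (simp only: refl if_True)
    moreover have "ip (p - g) (hprod_power z m) = 0"
      by (rule ip_orthogonal_sym[OF hprod_power_mem[OF z] diff g(2)[OF uz]])
    ultimately show ?thesis
      by simp
  qed
  then have "p = g"
    using eqI_ball assms(1) gH by blast
  then show ?thesis
    using g(1) by simp
qed

lemma homogeneous_orthogonal:
  assumes p: "p \<in> H" "homogeneous_polynomial m p" and q: "q \<in> H" "homogeneous_polynomial n q"
    and "m \<noteq> n"
  shows "ip p q = 0"
proof -
  have "q \<in> H \<and> ip p q = 0"
    using homogeneous_in_span_hprod_power[OF q]
  proof (rule fun_space.span_induct)
    show "fun_space.subspace {q. q \<in> H \<and> ip p q = 0}"
      using p(1) by (intro fun_space.subspaceI) (auto simp: ip_add_right ip_scale_right)
    show "u \<in> H \<and> ip p u = 0" if "u \<in> (\<lambda>w. hprod_power w n) ` {w. norm w < 1}" for u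
      using that assms(5) hprod_power_mem
        ip_hprod_power_homogeneous[OF _ p(1) homogeneous_polynomial_scaleR[OF p(2)], of _ n] by auto
  qed
  then show ?thesis by blast
qed

lemma ip_mult_coord_constant:
  assumes "f \<in> H" "mult_coord i f \<in> H" "q \<in> H" "homogeneous_polynomial 0 q"
  shows "ip (mult_coord i f) q = 0"
proof -
  have "q \<in> H \<and> ip (mult_coord i f) q = 0"
    using homogeneous_in_span_hprod_power[OF assms(3,4)]
  proof (rule fun_space.span_induct)
    show "fun_space.subspace {q. q \<in> H \<and> ip (mult_coord i f) q = 0}"
      using assms(2) by (intro fun_space.subspaceI) (auto simp: ip_add_right ip_scale_right)
    show "u \<in> H \<and> ip (mult_coord i f) u = 0" if "u \<in> (\<lambda>w. hprod_power w 0) ` {w. norm w < 1}" for u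
      using that hprod_power_mem ip_mult_coord_hprod_power_0[OF _ assms(1,2)] by auto
  qed
  then show ?thesis by blast
qed

text \<open>On polynomials of degree \<open>n + 1\<close> the adjoint of \<open>mult_coord j\<close> is \<open>(n + 1)\<^sup>-\<^sup>1\<close> times the \<open>j\<close>-th
  partial derivative.\<close>

definition partials :: "nat \<Rightarrow> (complex ^ 'd \<Rightarrow> complex) \<Rightarrow> ('d \<Rightarrow> complex ^ 'd \<Rightarrow> complex) \<Rightarrow> bool"
  where "partials n q q' \<longleftrightarrow> (\<forall>j. q' j \<in> H \<and> homogeneous_polynomial n (q' j)
    \<and> (\<forall>z. norm z < 1 \<longrightarrow> ((\<lambda>t. q (z + axis j t)) has_field_derivative q' j z) (at 0))
    \<and> (\<forall>z. norm z < 1 \<longrightarrow> (\<Sum>j\<in>UNIV. z $ j * q' j z) = of_nat (Suc n) * q z)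
    \<and> (\<forall>f. f \<in> H \<longrightarrow> mult_coord j f \<in> H \<longrightarrow> of_nat (Suc n) * ip (mult_coord j f) q = ip f (q' j)))"

lemma partialsI:
  assumes "\<And>j. q' j \<in> H" "\<And>j. homogeneous_polynomial n (q' j)"
    and "\<And>j z. norm z < 1 \<Longrightarrow> ((\<lambda>t. q (z + axis j t)) has_field_derivative q' j z) (at 0)"
    and "\<And>z. norm z < 1 \<Longrightarrow> (\<Sum>j\<in>UNIV. z $ j * q' j z) = of_nat (Suc n) * q z"
    and "\<And>j f. f \<in> H \<Longrightarrow> mult_coord j f \<in> H \<Longrightarrow> of_nat (Suc n) * ip (mult_coord j f) q = ip f (q' j)"
  shows "partials n q q'"
  unfolding partials_def using assms by blast

lemma partialsD:
  assumes "partials n q q'"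
  shows "q' j \<in> H" "homogeneous_polynomial n (q' j)"
    and "norm z < 1 \<Longrightarrow> ((\<lambda>t. q (z + axis j t)) has_field_derivative q' j z) (at 0)"
    and "norm z < 1 \<Longrightarrow> (\<Sum>j\<in>UNIV. z $ j * q' j z) = of_nat (Suc n) * q z"
    and "f \<in> H \<Longrightarrow> mult_coord j f \<in> H \<Longrightarrow> of_nat (Suc n) * ip (mult_coord j f) q = ip f (q' j)"
  using assms unfolding partials_def by blast+

lemma partials_zero: "partials n 0 (\<lambda>_. 0)"
proof (rule partialsI)
  show "homogeneous_polynomial n 0"
    using fun_space.subspace_0[OF homogeneous_polynomial_subspace] by blast
  show "of_nat (Suc n) * ip (mult_coord j f) 0 = ip f 0" if "f \<in> H" "mult_coord j f \<in> H" for j f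
    by (simp only: ip_zero_right[OF that(1)] ip_zero_right[OF that(2)] mult_zero_right)
qed simp_all

lemma partials_add:
  assumes "p \<in> H" "q \<in> H" and p': "partials n p p'" and q': "partials n q q'"
  shows "partials n (p + q) (\<lambda>j. p' j + q' j)"
proof (rule partialsI)
  note p = partialsD[OF p'] and q = partialsD[OF q']
  show "p' j + q' j \<in> H" for j
    using p(1) q(1) by (rule add_mem)
  show "homogeneous_polynomial n (p' j + q' j)" for j
    using p(2) q(2) by (rule homogeneous_polynomial_add)
  show "((\<lambda>t. (p + q) (z + axis j t)) has_field_derivative (p' j + q' j) z) (at 0)" if "norm z < 1" for z j
    unfolding plus_fun_apply by (intro DERIV_add p(3) q(3) that)
  show "(\<Sum>j\<in>UNIV. z $ j * (p' j + q' j) z) = of_nat (Suc n) * (p + q) z" if "norm z < 1" for z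
    unfolding plus_fun_apply distrib_left sum.distrib using p(4)[OF that] q(4)[OF that] by simp
  show "of_nat (Suc n) * ip (mult_coord j f) (p + q) = ip f (p' j + q' j)"
    if "f \<in> H" "mult_coord j f \<in> H" for j f
    unfolding ip_add_right[OF assms(1,2) that(2)] ip_add_right[OF p(1) q(1) that(1)] distrib_left
      p(5)[OF that] q(5)[OF that] ..
qed

lemma partials_cscale:
  assumes "q \<in> H" and q': "partials n q q'"
  shows "partials n (cscale c q) (\<lambda>j. cscale c (q' j))"
proof (rule partialsI)
  note q = partialsD[OF q']
  show "cscale c (q' j) \<in> H" for j
    using q(1) by (rule scale_mem)
  show "homogeneous_polynomial n (cscale c (q' j))" for j
    using q(2) by (rule homogeneous_polynomial_cscale)
  show "((\<lambda>t. cscale c q (z + axis j t)) has_field_derivative cscale c (q' j) z) (at 0)" if "norm z < 1" for z j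
    unfolding cscale_apply by (intro DERIV_cmult q(3) that)
  show "(\<Sum>j\<in>UNIV. z $ j * cscale c (q' j) z) = of_nat (Suc n) * cscale c q z" if "norm z < 1" for z
  proof -
    have "(\<Sum>j\<in>UNIV. z $ j * (c * q' j z)) = c * (\<Sum>j\<in>UNIV. z $ j * q' j z)"
      by (simp add: sum_distrib_left mult_ac)
    then show ?thesis
      unfolding cscale_apply q(4)[OF that] by (simp only: mult_ac)
  qed
  show "of_nat (Suc n) * ip (mult_coord j f) (cscale c q) = ip f (cscale c (q' j))"
    if "f \<in> H" "mult_coord j f \<in> H" for j f
    unfolding ip_scale_right[OF assms(1) that(2)] ip_scale_right[OF q(1) that(1)] q(5)[OF that, symmetric]
    by (simp only: mult_ac)
qed

text \<open>The partial derivative and the adjoint both turn <., w>^(n+1) into a multiple of cnj w_j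
  <., w>^n; the factors are n + 1 and 1, whence the weight in \<open>partials\<close>.\<close>

lemma partials_hprod_power:
  assumes w: "norm w < 1"
  shows "partials n (hprod_power w (Suc n)) (\<lambda>j. cscale (of_nat (Suc n) * cnj (w $ j)) (hprod_power w n))"
    (is "partials n ?u ?u'")
proof (rule partialsI)
  show "?u' j \<in> H" for j
    using hprod_power_mem[OF w] by (rule scale_mem)
  show "homogeneous_polynomial n (?u' j)" for j
    using homogeneous_polynomial_hprod_power by (rule homogeneous_polynomial_cscale)
  show "((\<lambda>t. ?u (z + axis j t)) has_field_derivative ?u' j z) (at 0)" if z: "norm z < 1" for z j
  proof -
    have h: "hprod (z + axis j t) w = hprod z w + t * cnj (w $ j)" for t
      by (simp add: hprod_def distrib_right sum.distrib axis_def if_distrib[of "\<lambda>x. x * _"] cong: if_cong)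
    have "((\<lambda>t. (hprod z w + t * cnj (w $ j)) ^ Suc n) has_field_derivative ?u' j z) (at 0)"
      by (rule derivative_eq_intros refl)+
        (simp add: cscale_apply hprod_power_apply[OF z] mult_ac)
    \<comment> \<open>\<open>hprod_power\<close> is cut off outside the ball, so it agrees with the
      differentiated formula only for t near 0.\<close>
    moreover have ev: "\<forall>\<^sub>F t in nhds 0. ?u (z + axis j t) = (hprod z w + t * cnj (w $ j)) ^ Suc n"
    proof -
      have "\<forall>\<^sub>F t :: complex in nhds 0. t \<in> ball 0 (1 - norm z)"
        using z by (intro eventually_nhds_in_open) simp_all
      then show ?thesis
      proof (rule eventually_mono)
        fix t :: complex assume t: "t \<in> ball 0 (1 - norm z)"
        have "norm (z + axis j t) \<le> norm z + norm t"
          using norm_triangle_ineq[of z "axis j t"] by (simp add: norm_axis)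
        then show "?u (z + axis j t) = (hprod z w + t * cnj (w $ j)) ^ Suc n"
          using t by (simp add: hprod_power_apply h del: power_Suc)
      qed
    qed
    ultimately show ?thesis
      unfolding DERIV_cong_ev[OF refl ev refl] by blast
  qed
  show "(\<Sum>j\<in>UNIV. z $ j * ?u' j z) = of_nat (Suc n) * ?u z" if z: "norm z < 1" for z
  proof -
    have "(\<Sum>j\<in>UNIV. z $ j * ?u' j z) = of_nat (Suc n) * (hprod z w * hprod_power w n z)"
      unfolding cscale_apply hprod_def sum_distrib_left sum_distrib_right
      by (intro sum.cong) (simp_all only: mult_ac)
    then show ?thesis
      by (simp only: hprod_power_apply[OF z] power_Suc)
  qed
  show "of_nat (Suc n) * ip (mult_coord j f) ?u = ip f (?u' j)" if "f \<in> H" "mult_coord j f \<in> H" for j f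
    unfolding ip_mult_coord_hprod_power_Suc[OF w that] ip_scale_right[OF hprod_power_mem[OF w] that(1)]
    by (simp add: mult_ac)
qed

text \<open>Every clause of \<open>partials\<close> survives linear combinations of the pairs (q,
  q'), so the case of powers suffices.\<close>

lemma partials_exist:
  assumes "q \<in> H" "homogeneous_polynomial (Suc n) q"
  shows "\<exists>q'. partials n q q'"
proof -
  have "q \<in> H \<and> (\<exists>q'. partials n q q')"
    using homogeneous_in_span_hprod_power[OF assms]
  proof (rule fun_space.span_induct)
    show "fun_space.subspace {q. q \<in> H \<and> (\<exists>q'. partials n q q')}"
    proof (rule fun_space.subspaceI)
      show "0 \<in> {q. q \<in> H \<and> (\<exists>q'. partials n q q')}"
        by (intro CollectI conjI zero_mem) (rule exI, rule partials_zero)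
    next
      fix p q assume pq: "p \<in> {q. q \<in> H \<and> (\<exists>q'. partials n q q')}" "q \<in> {q. q \<in> H \<and> (\<exists>q'. partials n q q')}"
      then obtain p' q' where "partials n p p'" "partials n q q'"
        by blast
      then have "partials n (p + q) (\<lambda>j. p' j + q' j)"
        using pq by (intro partials_add) auto
      then show "p + q \<in> {q. q \<in> H \<and> (\<exists>q'. partials n q q')}"
        using pq by blast
    next
      fix c q assume q: "q \<in> {q. q \<in> H \<and> (\<exists>q'. partials n q q')}"
      then obtain q' where "partials n q q'"
        by blast
      then have "partials n (cscale c q) (\<lambda>j. cscale c (q' j))"
        using q by (intro partials_cscale) auto
      then show "cscale c q \<in> {q. q \<in> H \<and> (\<exists>q'. partials n q q')}"
        using q by blast
    qed
  next
    fix u :: "complex ^ 'd \<Rightarrow> complex"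
    assume "u \<in> (\<lambda>w. hprod_power w (Suc n)) ` {w. norm w < 1}"
    then obtain w where w: "norm w < 1" "u = hprod_power w (Suc n)"
      by blast
    then show "u \<in> H \<and> (\<exists>q'. partials n u q')"
      using partials_hprod_power hprod_power_mem by blast
  qed
  then show ?thesis by blast
qed

lemma mult_coord_adjoint_homogeneous:
  assumes "q \<in> H" "homogeneous_polynomial (Suc n) q"
  shows "\<exists>r. r \<in> H \<and> homogeneous_polynomial n r
    \<and> (\<forall>f. f \<in> H \<longrightarrow> mult_coord i f \<in> H \<longrightarrow> ip (mult_coord i f) q = ip f r)"
proof -
  obtain q0 where q0: "partials n q q0"
    using partials_exist[OF assms] by blast
  define q' where "q' = q0 i"
  note q' = partialsD(1,2,5)[OF q0, where j = i, folded q'_def]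
  show ?thesis
  proof (intro exI conjI allI impI)
    show "cscale (inverse (of_nat (Suc n))) q' \<in> H"
      using q'(1) by blast
    show "homogeneous_polynomial n (cscale (inverse (of_nat (Suc n))) q')"
      using q'(2) by (rule homogeneous_polynomial_cscale)
    show "ip (mult_coord i f) q = ip f (cscale (inverse (of_nat (Suc n))) q')"
      if "f \<in> H" "mult_coord i f \<in> H" for f
      using q'(1) that by (simp add: ip_scale_right q'(3)[OF that, symmetric] field_simps del: of_nat_Suc)
  qed
qed

text \<open>Moving one z_j across the inner product turns the sum into <p, sum_j d_j (z_j p)> up to
  the degree n + 2. By the product rule and Euler's identity, sum_j d_j (z_j p) = (d + n + 1)
  p.\<close>

lemma sum_norm_mult_coord:
  assumes p: "p \<in> H" "homogeneous_polynomial (Suc n) p" and zp: "\<And>j. mult_coord j p \<in> H"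
  shows "of_nat (Suc (Suc n)) * (\<Sum>j\<in>UNIV. ip (mult_coord j p) (mult_coord j p))
    = of_nat (CARD('d) + Suc n) * ip p p"
proof -
  obtain p' where "partials n p p'"
    using partials_exist[OF p] by blast
  note p' = partialsD(3,4)[OF this]
  have "\<forall>j. \<exists>q. partials (Suc n) (mult_coord j p) q"
    using partials_exist[OF zp homogeneous_polynomial_mult_coord[OF p(2)]] by blast
  then obtain Q where Q: "\<And>j. partials (Suc n) (mult_coord j p) (Q j)"
    by metis
  \<comment> \<open>Only the diagonal partials enter: z_j p is differentiated in direction
    j.\<close>
  define q where "q j = Q j j" for j
  have q: "q j \<in> H"
    "norm z < 1 \<Longrightarrow> ((\<lambda>t. mult_coord j p (z + axis j t)) has_field_derivative q j z) (at 0)"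
    "of_nat (Suc (Suc n)) * ip (mult_coord j p) (mult_coord j p) = ip p (q j)" for j z
    unfolding q_def using partialsD(1,3,5)[OF Q] p(1) zp by blast+
  have q_apply: "q j z = p z + z $ j * p' j z" if z: "norm z < 1" for j z
  proof -
    have axis_0: "axis j 0 = (0 :: complex ^ 'd)"
      by simp
    have "((\<lambda>t. (z $ j + t) * p (z + axis j t)) has_field_derivative p z + z $ j * p' j z) (at 0)"
      by (rule derivative_eq_intros p'(1) z refl | simp add: axis_0)+
    then have "((\<lambda>t. mult_coord j p (z + axis j t)) has_field_derivative p z + z $ j * p' j z) (at 0)"
      by (simp add: mult_coord_def)
    then show ?thesis
      using q(2)[OF z] DERIV_unique by blast
  qed
  have "(\<Sum>j\<in>UNIV. q j) = cscale (of_nat (CARD('d) + Suc n)) p"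
  proof (rule eqI_ball)
    fix z :: "complex ^ 'd" assume z: "norm z < 1"
    have "(\<Sum>j\<in>UNIV. q j z) = of_nat CARD('d) * p z + of_nat (Suc n) * p z"
      using z by (simp add: q_apply sum.distrib p'(2)[OF z] del: of_nat_Suc)
    then show "(\<Sum>j\<in>UNIV. q j) z = cscale (of_nat (CARD('d) + Suc n)) p z"
      by (simp only: sum_fun_apply cscale_apply distrib_right of_nat_add)
  qed (use p q in \<open>auto intro: sum_mem\<close>)
  then have "(\<Sum>j\<in>UNIV. ip p (q j)) = of_nat (CARD('d) + Suc n) * ip p p"
    using p(1) q(1) by (simp add: ip_sum_right[symmetric] ip_scale_right)
  then show ?thesis
    unfolding sum_distrib_left q(3) .
qed

end

section \<open>Submodules of the Drury-Arveson space\<close>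

context drury_arveson
begin

text \<open>Closedness is continuity of the inner product. In \<open>step\<close> orthogonality to
  all of Q is available, since an adjoint may trade q for another member of Q.\<close>

lemma submodule_orthogonal:
  assumes S: "submodule H ip S" and Q: "Q \<subseteq> H"
    and step: "\<And>f i q. f \<in> S \<Longrightarrow> \<forall>q\<in>Q. ip f q = 0 \<Longrightarrow> q \<in> Q \<Longrightarrow> ip (mult_coord i f) q = 0"
  shows "submodule H ip {f \<in> S. \<forall>q\<in>Q. ip f q = 0}" (is "submodule H ip ?F")
proof -
  have SH: "S \<subseteq> H" and sub: "fun_space.subspace S" and cl: "hclosure H ip S \<subseteq> S"
    and mult: "\<And>i f. f \<in> S \<Longrightarrow> mult_coord i f \<in> S"
    using S unfolding submodule_def closed_subspace_def by blast+
  have "fun_space.subspace ?F"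
  proof (rule fun_space.subspaceI)
    show "0 \<in> ?F"
      using fun_space.subspace_0[OF sub] Q by (auto intro: ip_zero_left)
    show "f + g \<in> ?F" if "f \<in> ?F" "g \<in> ?F" for f g
      using that fun_space.subspace_add[OF sub] Q SH by (auto simp: ip_add subset_iff)
    show "cscale c f \<in> ?F" if "f \<in> ?F" for c f
      using that fun_space.subspace_scale[OF sub] Q SH by (auto simp: ip_scale subset_iff)
  qed
  moreover have "hclosure H ip ?F \<subseteq> ?F"
  proof
    fix l assume "l \<in> hclosure H ip ?F"
    then obtain X where X: "l \<in> H" "\<And>n::nat. X n \<in> ?F" "(\<lambda>n. hnorm ip (X n - l)) \<longlonglongrightarrow> 0"
      unfolding hclosure_def by blast
    then have "l \<in> hclosure H ip S"
      unfolding hclosure_def by blast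
    moreover have "ip l q = 0" if q: "q \<in> Q" for q
    proof -
      have XH: "X n \<in> H" and X0: "ip (X n) q = 0" for n
        using X(2)[of n] SH q by blast+
      have "(\<lambda>n. ip (X n) q) \<longlonglongrightarrow> ip l q"
        using q Q by (intro tendsto_ip[OF XH X(1) _ X(3)]) blast
      then show ?thesis
        unfolding X0 using LIMSEQ_unique[OF _ tendsto_const] by blast
    qed
    ultimately show "l \<in> ?F"
      using cl by blast
  qed
  ultimately show ?thesis
    using SH mult step unfolding submodule_def closed_subspace_def by blast
qed

text \<open>Induction over the generated closed submodule: the vectors of S orthogonal to Q form a
  submodule containing G, hence exhaust S.\<close>

lemma hull_orthogonal:
  assumes S: "submodule H ip S" "S = submodule H ip hull G" and Q: "Q \<subseteq> H"
    and gen: "\<And>g q. g \<in> G \<Longrightarrow> q \<in> Q \<Longrightarrow> ip g q = 0"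
    and step: "\<And>f i q. f \<in> S \<Longrightarrow> \<forall>q\<in>Q. ip f q = 0 \<Longrightarrow> q \<in> Q \<Longrightarrow> ip (mult_coord i f) q = 0"
    and "f \<in> S" "q \<in> Q"
  shows "ip f q = 0"
proof -
  have "G \<subseteq> S"
    using S(2) hull_subset by metis
  then have "G \<subseteq> {f \<in> S. \<forall>q\<in>Q. ip f q = 0}"
    using gen by blast
  then have "submodule H ip hull G \<subseteq> {f \<in> S. \<forall>q\<in>Q. ip f q = 0}"
    by (rule hull_minimal) (rule submodule_orthogonal[OF S(1) Q], rule step)
  then show ?thesis
    unfolding S(2)[symmetric] using assms(6,7) by blast
qed

lemma submodule_zero: "submodule H ip {0}"
proof -
  have "hclosure H ip {0} \<subseteq> {0}"
  proof
    fix l assume "l \<in> hclosure H ip {0}"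
    then obtain X where X: "l \<in> H" "\<And>n::nat. X n \<in> {0}" "(\<lambda>n. hnorm ip (X n - l)) \<longlonglongrightarrow> 0"
      unfolding hclosure_def by blast
    have XH: "X n \<in> H" and X0: "X n = 0" for n
      using X(2)[of n] by auto
    have "(\<lambda>n::nat. ip 0 l) \<longlonglongrightarrow> ip l l"
      using tendsto_ip[OF XH X(1,1,3)] unfolding X0 .
    then have "ip l l = ip 0 l"
      using LIMSEQ_unique[OF _ tendsto_const] by blast
    also have "\<dots> = 0"
      using X(1) by (rule ip_zero_left)
    finally show "l \<in> {0}"
      using ip_self_eq_0[OF X(1)] by blast
  qed
  moreover have "mult_coord i 0 = 0" for i :: 'd
    by (simp add: mult_coord_def fun_eq_iff)
  ultimately show ?thesis
    unfolding submodule_def closed_subspace_def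
    using zero_mem fun_space.subspace_single_0 by blast
qed

text \<open>With 1, S contains every power of the pairing. For f in H, what remains after projection
  to S is orthogonal to all powers and so vanishes at every point.\<close>

lemma submodule_containing_constant:
  assumes S: "submodule H ip S" "hilbert_space S ip" and one: "ball_monomial (\<lambda>_. 0) \<in> S"
  shows "S = H"
proof -
  have SH: "S \<subseteq> H" and sub: "fun_space.subspace S" and mult: "\<And>i f. f \<in> S \<Longrightarrow> mult_coord i f \<in> S"
    using S(1) unfolding submodule_def closed_subspace_def by blast+
  have powers: "hprod_power w n \<in> S" for w :: "complex ^ 'd" and n
  proof (induction n)
    case 0
    then show ?case
      using one by (simp add: hprod_power_0)
  next
    case (Suc n)
    then show ?case
      unfolding hprod_power_Suc
      by (intro fun_space.subspace_sum[OF sub] fun_space.subspace_scale[OF sub] mult)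
  qed
  have "f \<in> S" if f: "f \<in> H" for f
  proof -
    obtain g where g: "g \<in> S" "\<And>u. u \<in> S \<Longrightarrow> ip u (f - g) = 0"
      using orthogonal_projection[OF S(2) SH f] by blast
    have gH: "g \<in> H" and diff: "f - g \<in> H"
      using g(1) SH f by blast+
    have "f z = g z" if z: "norm z < 1" for z
    proof -
      have "ip (f - g) (hprod_power z n) = 0" for n
        by (rule ip_orthogonal_sym[OF hprod_power_mem[OF z] diff g(2)[OF powers]])
      then have "(f - g) z = 0"
        by (rule eq_0_if_orthogonal_hprod_power[OF z diff])
      then show ?thesis
        by simp
    qed
    then have "f = g"
      by (rule eqI_ball[OF f gH])
    then show ?thesis
      using g(1) by simp
  qed
  then show ?thesis
    using SH by blast
qed

end

section \<open>Consequences of maximality and the contradiction\<close>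

locale drury_arveson_submodule = drury_arveson H ip +
  coordinate_invariant H ip "ball 0 1" DA_kernel S
  for H :: "(complex ^ 'd \<Rightarrow> complex) set" and ip S
begin

lemma S_mem_H: "f \<in> S \<Longrightarrow> f \<in> H"
  using S_subset by blast

text \<open>Two independent polynomials \<open>p\<close>, \<open>q\<close> in the defect space satisfy the nontrivial relation
  \<open>q \<cdot> p - p \<cdot> q = 0\<close>.\<close>

lemma maximal_imp_collinear:
  assumes max: "maximal_tuple S ip (mult_coord :: 'd \<Rightarrow> _)"
    and p: "p \<in> defect_space" "homogeneous_polynomial m p" "p \<noteq> 0"
    and q: "q \<in> defect_space" "homogeneous_polynomial l q"
  shows "\<exists>c. q = cscale c p"
proof (rule ccontr)
  assume ncol: "\<not> (\<exists>c. q = cscale c p)"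
  have indp: "fun_space.independent {p}"
    using p(3) by (simp add: fun_space.dependent_single)
  have nq: "q \<notin> fun_space.span {p}"
    using ncol unfolding fun_space.span_singleton by blast
  then have ind: "fun_space.independent {q, p}"
    by (rule fun_space.independent_insertI[OF _ indp])
  have neq: "q \<noteq> p"
    using nq fun_space.span_base[of p "{p}"] by blast
  obtain cp where cp: "p = (\<Sum>a | sum a UNIV = m. cscale (cp a) (ball_monomial a))"
    using p(2) unfolding homogeneous_polynomial_iff by blast
  obtain cq where cq: "q = (\<Sum>a | sum a UNIV = l. cscale (cq a) (ball_monomial a))"
    using q(2) unfolding homogeneous_polynomial_iff by blast
  define n where "n = m + l + 1"
  \<comment> \<open>The relation q p - p q = 0 with one factor expanded: p carries the coefficients
    of q, and q carries the negated coefficients of p.\<close>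
  define k where "k a b = (if b = p then (if sum a UNIV = l then cq a else 0)
      else (if sum a UNIV = m then - cp a else 0))" for a :: "'d \<Rightarrow> nat" and b
  have sum_le: "(\<Sum>a\<in>exponents_below n. if sum a UNIV = j then h a else 0) = (\<Sum>a | sum a UNIV = j. h a)"
    if "j < n" for j and h :: "('d \<Rightarrow> nat) \<Rightarrow> complex"
    using that by (intro sum.mono_neutral_cong_right finite_exponents_below) (auto simp: exponents_below_def)
  have ln: "l < n" and mn: "m < n"
    by (simp_all add: n_def)
  have rel: "(\<Sum>a\<in>exponents_below n. \<Sum>b\<in>{q, p}. k a b * monomial a z * b z) = 0" for z
  proof (cases "norm z < 1")
    case True
    have "(\<Sum>a\<in>exponents_below n. \<Sum>b\<in>{q, p}. k a b * monomial a z * b z)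
        = (\<Sum>a\<in>exponents_below n. (if sum a UNIV = l then cq a * monomial a z * p z else 0)
            + (if sum a UNIV = m then - (cp a * monomial a z * q z) else 0))"
      using neq by (intro sum.cong) (auto simp: k_def)
    also have "\<dots> = (\<Sum>a | sum a UNIV = l. cq a * monomial a z * p z)
        + (\<Sum>a | sum a UNIV = m. - (cp a * monomial a z * q z))"
      unfolding sum.distrib sum_le[OF ln] sum_le[OF mn] ..
    also have "\<dots> = q z * p z - p z * q z"
      using True unfolding homogeneous_polynomial_apply[OF cp, of z] homogeneous_polynomial_apply[OF cq, of z]
      by (simp add: sum_negf flip: sum_distrib_right)
    finally show ?thesis
      by simp
  next
    case False
    then show ?thesis
      using homogeneous_polynomial_apply[OF cp, of z] homogeneous_polynomial_apply[OF cq, of z] neq by simp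
  qed
  \<comment> \<open>Independence annihilates the coefficients standing at q, which are those of p;
    so p would be zero.\<close>
  have "cp a = 0" if a: "sum a UNIV = m" for a
  proof -
    have "k a q = 0"
      by (rule maximal_imp_module_independent[OF max _ ind rel])
        (use p(1) q(1) a in \<open>auto simp: exponents_below_def n_def\<close>)
    then show ?thesis
      using a neq by (simp add: k_def)
  qed
  then have "p = (\<Sum>a | sum a UNIV = m. cscale 0 (ball_monomial a))"
    by (subst cp) (intro sum.cong, auto)
  then have "p = 0"
    by (simp only: fun_space.scale_zero_left sum.neutral_const)
  then show False
    using p(3) by blast
qed

text \<open>The relation says that the linear form z_j - sum_i c_i z_i annihilates p. By
  independence this form is zero, and its coefficient of z_j is 1 - c_j.\<close>

lemma maximal_imp_linear_factor_zero:
  assumes max: "maximal_tuple S ip (mult_coord :: 'd \<Rightarrow> _)"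
    and p: "p \<in> defect_space" "p \<noteq> 0"
    and rel: "mult_coord j p = (\<Sum>i\<in>UNIV. cscale (c i) (mult_coord i p))"
  shows "c j = 1"
proof -
  define e :: "'d \<Rightarrow> 'd \<Rightarrow> nat" where "e i = (\<lambda>k. if k = i then 1 else 0)" for i
  \<comment> \<open>Coefficients of that linear form; since it has degree 1, the relation is used
    with n = 2.\<close>
  define k where "k a b = (if a = e j then 1 else 0) - (\<Sum>i\<in>UNIV. if a = e i then c i else 0)"
    for a and b :: "complex ^ 'd \<Rightarrow> complex"
  have e_inj: "e i = e i' \<longleftrightarrow> i = i'" for i i'
    by (auto simp: e_def fun_eq_iff)
  have e_mem: "e i \<in> exponents_below 2" for i
    by (simp add: e_def exponents_below_def)
  have "k (e j) p = 0"
  proof (rule maximal_imp_module_independent[where P = "{p}" and n = 2 and c = k, OF max])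
    show "fun_space.independent {p}"
      using p(2) by (simp add: fun_space.dependent_single)
    fix z
    have "(\<Sum>a\<in>exponents_below 2. (if a = e i then b else 0) * x a) = b * x (e i)"
      for i and b and x :: "_ \<Rightarrow> complex"
      using e_mem by (simp add: if_distrib[of "\<lambda>x. x * _"] cong: if_cong)
    note delta = this
    have "(\<Sum>a\<in>exponents_below 2. k a p * (monomial a z * p z))
        = (\<Sum>a\<in>exponents_below 2. (if a = e j then 1 else 0) * (monomial a z * p z))
          - (\<Sum>i\<in>UNIV. \<Sum>a\<in>exponents_below 2. (if a = e i then c i else 0) * (monomial a z * p z))"
      by (subst sum.swap) (simp add: k_def left_diff_distrib sum_subtractf sum_distrib_right)
    also have "\<dots> = z $ j * p z - (\<Sum>i\<in>UNIV. c i * (z $ i * p z))"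
      unfolding delta by (simp add: e_def)
    also have "\<dots> = 0"
      using fun_cong[OF rel, of z] by (simp add: sum_fun_apply cscale_apply mult_coord_def)
    finally show "(\<Sum>a\<in>exponents_below 2. \<Sum>b\<in>{p}. k a b * monomial a z * b z) = 0"
      by (simp add: mult.assoc)
  qed (use p e_mem in auto)
  then show ?thesis
    by (simp add: k_def e_inj)
qed

lemma homogeneous_not_maximal:
  assumes d: "CARD('d) \<ge> 2" and hom: "homogeneous_submodule H ip S" and S: "S \<noteq> {0}" "S \<noteq> H"
    and max: "maximal_tuple S ip (mult_coord :: 'd \<Rightarrow> _)"
  shows False
proof -
  obtain G where sub: "submodule H ip S" and G: "\<And>g. g \<in> G \<Longrightarrow> \<exists>k. homogeneous_polynomial k g"
    and SG: "S = submodule H ip hull G"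
    using hom unfolding homogeneous_submodule_def by blast
  have GS: "G \<subseteq> S"
    using SG hull_subset by metis
  have "\<exists>m. \<exists>p\<in>S. homogeneous_polynomial m p \<and> p \<noteq> 0"
  proof (rule ccontr)
    assume "\<not> ?thesis"
    then have "G \<subseteq> {0}"
      using G GS by blast
    then have "submodule H ip hull G \<subseteq> {0}"
      by (rule hull_minimal) (rule submodule_zero)
    then have "S \<subseteq> {0}"
      unfolding SG[symmetric] .
    then show False
      using S(1) S.zero_mem by blast
  qed
  then obtain m where "\<exists>p\<in>S. homogeneous_polynomial m p \<and> p \<noteq> 0"
    and least: "\<And>k. k < m \<Longrightarrow> \<not> (\<exists>p\<in>S. homogeneous_polynomial k p \<and> p \<noteq> 0)"
    using exists_least_iff[of "\<lambda>m. \<exists>p\<in>S. homogeneous_polynomial m p \<and> p \<noteq> 0"] by blast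
  then obtain p where p: "p \<in> S" "homogeneous_polynomial m p" "p \<noteq> 0"
    by blast
  have low_0: "q = 0" if "q \<in> S" "homogeneous_polynomial k q" "k < m" for k q
    using least that by blast
  define Q where "Q = {q \<in> H. \<exists>k<m. homogeneous_polynomial k q}"
  \<comment> \<open>Degree k = m is included, one above \<open>Q\<close>: the adjoint of
    multiplication lowers the degree by one, so the pairing becomes one with a member of
    \<open>Q\<close>. In degree 0 it vanishes outright.\<close>
  have Q_step: "ip (mult_coord i f) q = 0"
    if f: "f \<in> S" "\<forall>q\<in>Q. ip f q = 0" and q: "q \<in> H" "homogeneous_polynomial k q" "k \<le> m" for f i q k
  proof (cases k)
    case 0
    then show ?thesis
      using ip_mult_coord_constant[OF S_mem_H[OF f(1)] S_mem_H[OF mult_coord_mem[OF f(1)]] q(1)] q(2)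
      by blast
  next
    case (Suc n)
    obtain r where r: "r \<in> H" "homogeneous_polynomial n r"
        "\<And>f. f \<in> H \<Longrightarrow> mult_coord i f \<in> H \<Longrightarrow> ip (mult_coord i f) q = ip f r"
      using mult_coord_adjoint_homogeneous[OF q(1) q(2)[unfolded Suc], of i] by blast
    have "n < m"
      using Suc q(3) by simp
    then have "r \<in> Q"
      unfolding Q_def using r(1,2) by blast
    then have "ip f r = 0"
      using f(2) by blast
    then show ?thesis
      using r(3)[OF S_mem_H[OF f(1)] S_mem_H[OF mult_coord_mem[OF f(1)]]] by simp
  qed
  \<comment> \<open>Generators of degree below m are zero by the choice of m; the others are
    orthogonal to \<open>Q\<close> by degree.\<close>
  have Q_orth: "ip f q = 0" if "f \<in> S" "q \<in> Q" for f q
  proof (rule hull_orthogonal[OF sub SG _ _ _ that])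
    show "ip g q = 0" if g: "g \<in> G" and q: "q \<in> Q" for g q
    proof -
      obtain k j where kj: "homogeneous_polynomial k g" "homogeneous_polynomial j q" "j < m" "q \<in> H"
        using G[OF g] q unfolding Q_def by blast
      show ?thesis
      proof (cases "k < m")
        case True
        then have "g = 0"
          using low_0 kj(1) g GS by blast
        then show ?thesis
          using kj(4) ip_zero_left by blast
      next
        case False
        then show ?thesis
          using homogeneous_orthogonal[OF S_mem_H kj(1,4,2)] kj(3) g GS by auto
      qed
    qed
    show "ip (mult_coord i f) q = 0" if "f \<in> S" "\<forall>q\<in>Q. ip f q = 0" "q \<in> Q" for f i q
      using Q_step[OF that(1,2)] that(3) unfolding Q_def using less_imp_le by blast
  qed (auto simp: Q_def)
  \<comment> \<open>For q of degree m every z_i f with f in S is orthogonal to q, so all adjoints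
    vanish at q and D fixes it.\<close>
  have in_defect: "q \<in> defect_space" if q: "q \<in> S" "homogeneous_polynomial m q" for q
  proof -
    have "shift_adj i q = 0" for i
      using Q_step[OF _ _ S_mem_H[OF q(1)] q(2)] Q_orth S.ip_zero_right
      by (intro S.adjoint_op_eqI) auto
    moreover have "mult_coord i 0 = 0" for i :: 'd
      by (simp add: mult_coord_def fun_eq_iff)
    ultimately have "defect q = q"
      by (simp only: defect_def Psi_def id_apply sum.neutral_const diff_zero)
    then show ?thesis
      unfolding defect_space_def using q(1) fun_space.span_base[of q "defect ` S"] by (metis imageI)
  qed
  note pH = S_mem_H[OF p(1)]
  have pE: "p \<in> defect_space"
    by (rule in_defect[OF p(1,2)])
  have pp: "ip p p \<noteq> 0"
    using ip_self_eq_0[OF pH] p(3) by blast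
  have S_m: "\<exists>c. q = cscale c p" if "q \<in> S" "homogeneous_polynomial m q" for q
    by (rule maximal_imp_collinear[OF max pE p(2,3) in_defect[OF that] that(2)])
  \<comment> \<open>The adjoint taken within S, at z_j p, is the projection to S of a degree m
    polynomial r of H. Orthogonality of S to \<open>R\<close> says that only the component of r
    along p survives.\<close>
  define R where "R = {r \<in> H. homogeneous_polynomial m r \<and> ip p r = 0}"
  have R_orth: "ip f r = 0" if "f \<in> S" "r \<in> R" for f r
  proof (rule hull_orthogonal[OF sub SG _ _ _ that])
    show "ip g r = 0" if g: "g \<in> G" and r: "r \<in> R" for g r
    proof -
      obtain k where k: "homogeneous_polynomial k g"
        using G[OF g] by blast
      have rH: "r \<in> H" "homogeneous_polynomial m r" "ip p r = 0"
        using r unfolding R_def by blast+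
      show ?thesis
      proof (cases "k = m")
        case True
        then obtain c where "g = cscale c p"
          using S_m k g GS by blast
        then show ?thesis
          using ip_scale[OF pH rH(1)] rH(3) by simp
      next
        case False
        then show ?thesis
          using homogeneous_orthogonal[OF S_mem_H k rH(1,2)] g GS by blast
      qed
    qed
    show "ip (mult_coord i f) r = 0" if "f \<in> S" "r \<in> R" for f i r
      using Q_step[OF that(1) _ _ _ order_refl] Q_orth[OF that(1)] that(2) unfolding R_def by blast
  qed (auto simp: R_def)
  \<comment> \<open>The coefficient of that component; the order of the factors accounts for
    conjugate linearity in the second argument.\<close>
  define c where "c i j = ip (mult_coord j p) (mult_coord i p) / ip p p" for i j
  note zpS = mult_coord_mem[OF p(1)]
  note zpH = S_mem_H[OF zpS]
  have adj: "shift_adj i (mult_coord j p) = cscale (c i j) p" for i j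
  proof (rule S.adjoint_op_eqI)
    show "cscale (c i j) p \<in> S"
      using p(1) by blast
    fix f assume f: "f \<in> S"
    obtain r where r: "r \<in> H" "homogeneous_polynomial m r"
        "\<And>f. f \<in> H \<Longrightarrow> mult_coord i f \<in> H \<Longrightarrow> ip (mult_coord i f) (mult_coord j p) = ip f r"
      using mult_coord_adjoint_homogeneous[OF zpH homogeneous_polynomial_mult_coord[OF p(2)], of i j] by blast
    have cpH: "cscale (c i j) p \<in> H"
      using pH by blast
    have "cnj (c i j) * ip p p = ip (mult_coord i p) (mult_coord j p)"
      using pp ip_commute[OF zpH[of j] zpH[of i]] ip_commute[OF pH pH] by (simp add: c_def)
    then have "ip p (r - cscale (c i j) p) = 0"
      unfolding ip_diff_right[OF r(1) cpH pH] ip_scale_right[OF pH pH] r(3)[OF pH zpH] by simp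
    then have "r - cscale (c i j) p \<in> R"
      unfolding R_def using r(1,2) cpH p(2) homogeneous_polynomial_diff homogeneous_polynomial_cscale by blast
    then have "ip f (r - cscale (c i j) p) = 0"
      by (rule R_orth[OF f])
    then show "ip (mult_coord i f) (mult_coord j p) = ip f (cscale (c i j) p)"
      unfolding ip_diff_right[OF r(1) cpH S_mem_H[OF f]] r(3)[OF S_mem_H[OF f] S_mem_H[OF mult_coord_mem[OF f]]]
      by simp
  qed
  have defect_zp: "defect (mult_coord j p) = mult_coord j p - (\<Sum>i\<in>UNIV. cscale (c i j) (mult_coord i p))" for j
    by (simp only: defect_def Psi_def id_apply adj mult_coord_cscale)
  \<comment> \<open>D (z_j p) lies in the defect space, so collinearity makes it a multiple of p;
    having degree m + 1, it is also orthogonal to p, hence zero.\<close>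
  have zp_rel: "mult_coord j p = (\<Sum>i\<in>UNIV. cscale (c i j) (mult_coord i p))" for j
  proof -
    let ?q = "defect (mult_coord j p)"
    have hom_q: "homogeneous_polynomial (Suc m) ?q"
      unfolding defect_zp
      by (intro homogeneous_polynomial_diff homogeneous_polynomial_sum homogeneous_polynomial_cscale
          homogeneous_polynomial_mult_coord p(2))
    have "?q \<in> defect_space"
      unfolding defect_space_def using zpS by (intro fun_space.span_base imageI)
    then obtain b where b: "?q = cscale b p"
      using maximal_imp_collinear[OF max pE p(2,3) _ hom_q] by blast
    have qH: "?q \<in> H"
      by (intro S_mem_H defect_mem zpS)
    have "ip p ?q = 0"
      by (rule homogeneous_orthogonal[OF pH p(2) qH hom_q]) simp
    then have "b = 0"
      unfolding b ip_scale_right[OF pH pH] using pp by simp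
    then have "?q = 0"
      using b fun_space.scale_zero_left[of p] by metis
    then show ?thesis
      unfolding defect_zp right_minus_eq .
  qed
  have norm_zp: "ip (mult_coord j p) (mult_coord j p) = ip p p" for j
    using maximal_imp_linear_factor_zero[OF max pE p(3) zp_rel, of j] pp by (simp add: c_def)
  have "m = 0"
  proof (cases m)
    case (Suc n)
    have "of_nat (Suc (Suc n)) * (of_nat CARD('d) * ip p p) = of_nat (CARD('d) + Suc n) * ip p p"
      using sum_norm_mult_coord[OF pH p(2)[unfolded Suc] zpH] unfolding norm_zp by simp
    then have "of_nat (Suc (Suc n) * CARD('d)) = (of_nat (CARD('d) + Suc n) :: complex)"
      unfolding of_nat_mult mult.assoc[symmetric] mult_right_cancel[OF pp] .
    then have "Suc (Suc n) * CARD('d) = CARD('d) + Suc n"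
      by (simp only: of_nat_eq_iff)
    then have "Suc n * CARD('d) = Suc n * 1"
      by simp
    then show ?thesis
      using d unfolding mult_cancel1 by linarith
  qed
  then obtain b where b: "p = cscale b (ball_monomial (\<lambda>_. 0))"
  proof -
    have "{a :: 'd \<Rightarrow> nat. sum a UNIV = 0} = {\<lambda>_. 0}"
      by (auto simp: fun_eq_iff)
    then show ?thesis
      using p(2) that unfolding \<open>m = 0\<close> homogeneous_polynomial_span
      by (auto simp: fun_space.span_singleton)
  qed
  have "b \<noteq> 0"
    using b p(3) fun_space.scale_zero_left by blast
  have "ball_monomial (\<lambda>_. 0) = cscale (inverse b) p"
    unfolding b by (simp only: fun_space.scale_scale left_inverse[OF \<open>b \<noteq> 0\<close>] fun_space.scale_one)
  then have "ball_monomial (\<lambda>_. 0) \<in> S"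
    using p(1) S.scale_mem by metis
  then show False
    using submodule_containing_constant[OF sub S_hilbert] S(2) by blast
qed

end

theorem theorem4p3:
  fixes H S :: "(complex ^ 'd \<Rightarrow> complex) set"
    and ip :: "(complex ^ 'd) inner_prod"
  assumes "CARD('d) \<ge> 2"
    and "drury_arveson H ip"
    and "homogeneous_submodule H ip S"
    and "S \<noteq> {0}" and "S \<noteq> H"
    and "Delta S ip (mult_coord :: 'd \<Rightarrow> (complex ^ 'd) operator) 1 < \<infinity>"
  shows "\<not> maximal_submodule H ip S"
proof
  assume "maximal_submodule H ip S"
  then have sub: "submodule H ip S" and max: "maximal_tuple S ip (mult_coord :: 'd \<Rightarrow> (complex ^ 'd) operator)"
    by (auto simp: maximal_submodule_def)
  interpret drury_arveson H ip
    by (rule assms(2))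
  interpret S: hilbert_space S ip
    using max unfolding maximal_tuple_def by blast
  interpret drury_arveson_submodule H ip S
  proof unfold_locales
    show "S \<subseteq> H"
      using sub by (simp add: submodule_def closed_subspace_def)
    show "bounded_operator S ip (mult_coord i)" for i
      using max by (simp add: maximal_tuple_def commuting_contractive_def)
  qed
  show False
    by (rule homogeneous_not_maximal[OF assms(1,3-5) max])
qed

end
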